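(* Let $R$ be a nonzero unital associative ring, let $\delta : R \to R$ be a derivation, and let $S := R[x;\delta]$ be the corresponding differential polynomial ring. The following four assertions are equivalent: (i) $R[x;\delta]$ is strongly simple. (ii) $R$ is a simple ring with $\operatorname{char}(R)=0$ and $S$ is a simple ring. (iii) $R$ is a simple ring with $\operatorname{char}(R)=0$ and $\delta$ is outer. (iv) $R$ is a simple ring with $\operatorname{char}(R)=0$ and $C_S(R)=Z(R)$.
   Context: Rings are associative and unital, not necessarily commutative. A derivation $\delta : R \to R$ is an additive map with $\delta(ab)=\delta(a)b+a\delta(b)$ for all $a,b \in R$. It is inner if there is some $a \in R$ such that $\delta(r)=ar-ra$ for every $r \in R$, and outer if it is not inner. The differential polynomial ring $R[x;\delta]$ is the free left $R$-module with basis $\{x^i\}_{i \in \mathbb{Z}_{\geq 0}}$, with the (associative, unital) multiplication determined by $x^i x^j = x^{i+j}$ and $xr = rx+\delta(r)$ for every $r \in R$; $R$ is a subring of it via $r \mapsto r x^0$. The ring $R[x;\delta]$ is an $R$-bimodule via left and right multiplication by elements of $R$, and an $R$-sub-bimodule is an additive subgroup closed under left and right multiplication by elements of $R$. The ring $R[x;\delta]$ is called strongly simple if each nonzero $R$-sub-bimodule of $R[x;\delta]$ is equal to $R[x;\delta]$ or to $\sum_{i=0}^n R x^i$ for some $n \in \mathbb{Z}_{\geq 0}$. A ring is simple if it is nonzero and its only two-sided ideals are zero and itself. $Z(R)$ denotes the center of $R$, and $C_S(R):=\{s \in S \mid sr=rs \text{ for all } r \in R\}$ is the centralizer of $R$ in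 $S$. *)

theory Defs
  imports "HOL-Algebra.UnivPoly"
begin

section \<open>Rings: simplicity, characteristic, centralizers, derivations\<close>

definition simple_ring :: "('a, 'm) ring_scheme \<Rightarrow> bool" where
  "simple_ring R \<longleftrightarrow>
     ring R \<and> carrier R \<noteq> {\<zero>\<^bsub>R\<^esub>} \<and> (\<forall>I. ideal I R \<longrightarrow> I = {\<zero>\<^bsub>R\<^esub>} \<or> I = carrier R)"

definition ring_characteristic :: "('a, 'm) ring_scheme \<Rightarrow> nat" where
  "ring_characteristic R =
     (if \<exists>n::nat. 0 < n \<and> [n] \<cdot>\<^bsub>R\<^esub> \<one>\<^bsub>R\<^esub> = \<zero>\<^bsub>R\<^esub>
      then (LEAST n::nat. 0 < n \<and> [n] \<cdot>\<^bsub>R\<^esub> \<one>\<^bsub>R\<^esub> = \<zero>\<^bsub>R\<^esub>) else 0)"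

definition ring_center :: "('a, 'm) ring_scheme \<Rightarrow> 'a set" where
  "ring_center R = {z \<in> carrier R. \<forall>r\<in>carrier R. z \<otimes>\<^bsub>R\<^esub> r = r \<otimes>\<^bsub>R\<^esub> z}"

definition ring_centralizer :: "('a, 'm) ring_scheme \<Rightarrow> 'a set \<Rightarrow> 'a set" where
  "ring_centralizer S A = {s \<in> carrier S. \<forall>r\<in>A. s \<otimes>\<^bsub>S\<^esub> r = r \<otimes>\<^bsub>S\<^esub> s}"

locale ring_derivation = ring R for R (structure) +
  fixes \<delta> :: "'a \<Rightarrow> 'a"
  assumes deriv_closed [simp, intro]: "a \<in> carrier R \<Longrightarrow> \<delta> a \<in> carrier R"
    and deriv_add: "\<lbrakk>a \<in> carrier R; b \<in> carrier R\<rbrakk> \<Longrightarrow> \<delta> (a \<oplus> b) = \<delta> a \<oplus> \<delta> b"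
    and deriv_mult: "\<lbrakk>a \<in> carrier R; b \<in> carrier R\<rbrakk> \<Longrightarrow> \<delta> (a \<otimes> b) = \<delta> a \<otimes> b \<oplus> a \<otimes> \<delta> b"

definition inner_derivation :: "('a, 'm) ring_scheme \<Rightarrow> ('a \<Rightarrow> 'a) \<Rightarrow> bool" where
  "inner_derivation R \<delta> \<longleftrightarrow>
     (\<exists>a\<in>carrier R. \<forall>r\<in>carrier R. \<delta> r = a \<otimes>\<^bsub>R\<^esub> r \<ominus>\<^bsub>R\<^esub> r \<otimes>\<^bsub>R\<^esub> a)"

definition outer_derivation :: "('a, 'm) ring_scheme \<Rightarrow> ('a \<Rightarrow> 'a) \<Rightarrow> bool" where
  "outer_derivation R \<delta> \<longleftrightarrow> \<not> inner_derivation R \<delta>"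


section \<open>The differential polynomial ring\<close>

text \<open>
  Left multiplication by \<open>x\<close> on finitely supported coefficient functions. From
  \<open>x (r x\<^sup>j) = (r x + \<delta>(r)) x\<^sup>j\<close> one gets
  \<open>x (\<Sum>\<^sub>j q\<^sub>j x\<^sup>j) = \<Sum>\<^sub>j q\<^sub>j x\<^bsup>j+1\<^esup> + \<Sum>\<^sub>j \<delta>(q\<^sub>j) x\<^sup>j\<close>.
\<close>

definition dp_x_mult :: "('a, 'm) ring_scheme \<Rightarrow> ('a \<Rightarrow> 'a) \<Rightarrow> (nat \<Rightarrow> 'a) \<Rightarrow> nat \<Rightarrow> 'a" where
  "dp_x_mult R \<delta> q = (\<lambda>n. (case n of 0 \<Rightarrow> \<zero>\<^bsub>R\<^esub> | Suc m \<Rightarrow> q m) \<oplus>\<^bsub>R\<^esub> \<delta> (q n))"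

text \<open>
  As a left \<open>R\<close>-module, \<open>R[x;\<delta>]\<close> is the same free module as the ordinary polynomial ring
  \<^const>\<open>UP\<close> (which also provides the unit and \<^const>\<open>monom\<close>, where \<open>monom r i\<close> is \<open>r x\<^sup>i\<close>);
  only the product is changed, to \<open>(\<Sum>\<^sub>i p\<^sub>i x\<^sup>i) q = \<Sum>\<^sub>i p\<^sub>i (x\<^sup>i q)\<close>.
\<close>

definition diff_poly :: "('a, 'm) ring_scheme \<Rightarrow> ('a \<Rightarrow> 'a) \<Rightarrow> ('a, nat \<Rightarrow> 'a) up_ring" where
  "diff_poly R \<delta> = (UP R)\<lparr>mult := (\<lambda>p\<in>up R. \<lambda>q\<in>up R. \<lambda>n.
     \<Oplus>\<^bsub>R\<^esub>i \<in> {..deg R p}. p i \<otimes>\<^bsub>R\<^esub> (dp_x_mult R \<delta> ^^ i) q n)\<rparr>"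

definition dp_const :: "('a, 'm) ring_scheme \<Rightarrow> ('a \<Rightarrow> 'a) \<Rightarrow> 'a \<Rightarrow> nat \<Rightarrow> 'a" where
  "dp_const R \<delta> r = monom (diff_poly R \<delta>) r 0"

definition dp_x :: "('a, 'm) ring_scheme \<Rightarrow> ('a \<Rightarrow> 'a) \<Rightarrow> nat \<Rightarrow> 'a" where
  "dp_x R \<delta> = monom (diff_poly R \<delta>) \<one>\<^bsub>R\<^esub> 1"

definition dp_subbimodule :: "('a, 'm) ring_scheme \<Rightarrow> ('a \<Rightarrow> 'a) \<Rightarrow> (nat \<Rightarrow> 'a) set \<Rightarrow> bool" where
  "dp_subbimodule R \<delta> M \<longleftrightarrow>
     additive_subgroup M (diff_poly R \<delta>) \<and>
     (\<forall>r\<in>carrier R. \<forall>m\<in>M.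
        dp_const R \<delta> r \<otimes>\<^bsub>diff_poly R \<delta>\<^esub> m \<in> M \<and> m \<otimes>\<^bsub>diff_poly R \<delta>\<^esub> dp_const R \<delta> r \<in> M)"

text \<open>The set \<open>\<Sum>\<^bsub>i=0\<^esub>\<^bsup>n\<^esup> R x\<^sup>i\<close>.\<close>

definition dp_filtration :: "('a, 'm) ring_scheme \<Rightarrow> ('a \<Rightarrow> 'a) \<Rightarrow> nat \<Rightarrow> (nat \<Rightarrow> 'a) set" where
  "dp_filtration R \<delta> n =
     {(\<Oplus>\<^bsub>diff_poly R \<delta>\<^esub>i \<in> {..n}. dp_const R \<delta> (a i) \<otimes>\<^bsub>diff_poly R \<delta>\<^esub> dp_x R \<delta> [^]\<^bsub>diff_poly R \<delta>\<^esub> i)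
      | a. a \<in> {..n} \<rightarrow> carrier R}"

definition strongly_simple :: "('a, 'm) ring_scheme \<Rightarrow> ('a \<Rightarrow> 'a) \<Rightarrow> bool" where
  "strongly_simple R \<delta> \<longleftrightarrow>
     (\<forall>M. dp_subbimodule R \<delta> M \<and> M \<noteq> {\<zero>\<^bsub>diff_poly R \<delta>\<^esub>} \<longrightarrow>
        M = carrier (diff_poly R \<delta>) \<or> (\<exists>n. M = dp_filtration R \<delta> n))"


section \<open>The product of \<open>R[x;\<delta>]\<close> is associative and satisfies the defining relations\<close>

lemma diff_poly_simps [simp]:
  "carrier (diff_poly R \<delta>) = up R"
  "one (diff_poly R \<delta>) = one (UP R)"
  "zero (diff_poly R \<delta>) = zero (UP R)"
  "add (diff_poly R \<delta>) = add (UP R)"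
  "smult (diff_poly R \<delta>) = smult (UP R)"
  "monom (diff_poly R \<delta>) = monom (UP R)"
  "coeff (diff_poly R \<delta>) = coeff (UP R)"
  by (simp_all add: diff_poly_def UP_def)

lemma diff_poly_add_monoid: "add_monoid (diff_poly R \<delta>) = add_monoid (UP R)"
  by (simp add: diff_poly_def UP_def)

lemma diff_poly_finsum: "finsum (diff_poly R \<delta>) = finsum (UP R)"
  by (intro ext) (simp only: finsum_def diff_poly_add_monoid)

context ring_derivation
begin

lemma UP_ring_R: "UP_ring R"
  by unfold_locales

lemma UP_carrier: "carrier (UP R) = up R"
  by (simp add: UP_def)

lemma deriv_zero [simp]: "\<delta> \<zero> = \<zero>"
proof -
  have "\<delta> \<zero> \<oplus> \<delta> \<zero> = \<delta> \<zero> \<oplus> \<zero>"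
    using deriv_add[of \<zero> \<zero>] by simp
  then show ?thesis
    by simp
qed

lemma deriv_one [simp]: "\<delta> \<one> = \<zero>"
proof -
  have "\<delta> \<one> \<oplus> \<delta> \<one> = \<delta> \<one> \<oplus> \<zero>"
    using deriv_mult[of \<one> \<one>] by simp
  then show ?thesis
    by simp
qed

lemma deriv_finsum:
  assumes "finite A" "f \<in> A \<rightarrow> carrier R"
  shows "\<delta> (\<Oplus>i\<in>A. f i) = (\<Oplus>i\<in>A. \<delta> (f i))"
  using assms
proof (induction A rule: finite_induct)
  case (insert x F)
  then have "f \<in> F \<rightarrow> carrier R" "f x \<in> carrier R" "(\<lambda>i. \<delta> (f i)) \<in> F \<rightarrow> carrier R"
    by (auto simp: Pi_def)
  with insert show ?case
    by (simp add: deriv_add)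
qed simp

abbreviation xm where "xm \<equiv> dp_x_mult R \<delta>"

lemma xm_closed: "q \<in> up R \<Longrightarrow> xm q \<in> up R"
proof
  fix n assume q: "q \<in> up R"
  then show "xm q n \<in> carrier R"
    by (auto simp: dp_x_mult_def split: nat.split)
next
  assume q: "q \<in> up R"
  then obtain N where N: "bound \<zero> N q" by auto
  have "bound \<zero> (Suc N) (xm q)"
  proof
    fix m assume "Suc N < m"
    then obtain k where "m = Suc k" "N < k" by (cases m) auto
    with N have "q m = \<zero>" "q k = \<zero>" by (auto simp: bound_def)
    then show "xm q m = \<zero>"
      by (simp add: dp_x_mult_def \<open>m = Suc k\<close>)
  qed
  then show "\<exists>n. bound \<zero> n (xm q)" ..
qed

lemma xm_pow_closed: "q \<in> up R \<Longrightarrow> (xm ^^ i) q \<in> up R"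
  by (induction i) (auto intro: xm_closed)

lemma xm_pow_coeff_closed [simp]: "q \<in> up R \<Longrightarrow> (xm ^^ i) q n \<in> carrier R"
  using xm_pow_closed by blast

lemma deg_zero_above:
  assumes "p \<in> up R" "deg R p < i" shows "p i = \<zero>"
  using UP_ring.deg_aboveD[OF UP_ring_R, of p i] assms by (simp add: UP_def)

lemma finsum_extend:
  assumes "p \<in> up R" "\<And>i. N < i \<Longrightarrow> p i = \<zero>" "\<And>i. f i \<in> carrier R"
  shows "(\<Oplus>i\<in>{..deg R p}. p i \<otimes> f i) = (\<Oplus>i\<in>{..N}. p i \<otimes> f i)"
proof -
  have pc: "p i \<in> carrier R" for i using assms(1) by auto
  have le: "(\<Oplus>i\<in>{..a}. p i \<otimes> f i) = (\<Oplus>i\<in>{..b}. p i \<otimes> f i)"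
    if "a \<le> b" "\<And>i. a < i \<Longrightarrow> p i = \<zero>" for a b :: nat
    by (rule add.finprod_mono_neutral_cong_left) (use that assms pc in auto)
  show ?thesis
  proof (cases "deg R p \<le> N")
    case True
    then show ?thesis using le deg_zero_above[OF assms(1)] by blast
  next
    case False
    then show ?thesis using le[of N "deg R p"] assms(2) by simp
  qed
qed

lemma dp_mult_coeff:
  assumes "p \<in> up R" "q \<in> up R" "\<And>i. N < i \<Longrightarrow> p i = \<zero>"
  shows "(p \<otimes>\<^bsub>diff_poly R \<delta>\<^esub> q) n = (\<Oplus>i\<in>{..N}. p i \<otimes> (xm ^^ i) q n)"
  using assms by (simp add: diff_poly_def finsum_extend)

lemma up_bound_ex: "p \<in> up R \<Longrightarrow> \<exists>N. \<forall>i>N. p i = \<zero>"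
  by (auto dest!: bound_upD simp: bound_def)

lemma xm_pow_bound:
  assumes "q \<in> up R" "\<And>i. N < i \<Longrightarrow> q i = \<zero>" "N + i < n"
  shows "(xm ^^ i) q n = \<zero>"
  using assms(3)
proof (induction i arbitrary: n)
  case (Suc i)
  from Suc.prems obtain k where k: "n = Suc k" "N + i < k" by (cases n) auto
  with Suc.IH[of n] Suc.IH[of k] show ?case
    by (simp add: dp_x_mult_def)
qed (use assms in auto)

lemma dp_mult_closed:
  assumes p: "p \<in> up R" and q: "q \<in> up R"
  shows "p \<otimes>\<^bsub>diff_poly R \<delta>\<^esub> q \<in> up R"
proof
  fix n
  show "(p \<otimes>\<^bsub>diff_poly R \<delta>\<^esub> q) n \<in> carrier R"
    using p q by (auto simp: diff_poly_def intro!: finsum_closed)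
next
  obtain N where N: "\<And>i. N < i \<Longrightarrow> p i = \<zero>" using up_bound_ex[OF p] by blast
  obtain M where M: "\<And>i. M < i \<Longrightarrow> q i = \<zero>" using up_bound_ex[OF q] by blast
  have "(p \<otimes>\<^bsub>diff_poly R \<delta>\<^esub> q) n = \<zero>" if "M + N < n" for n
  proof -
    have "(\<Oplus>i\<in>{..N}. p i \<otimes> (xm ^^ i) q n) = (\<Oplus>i\<in>{..N}. \<zero>)"
    proof (rule finsum_cong')
      fix i assume "i \<in> {..N}"
      then have "(xm ^^ i) q n = \<zero>" using xm_pow_bound[OF q M] that by simp
      then show "p i \<otimes> (xm ^^ i) q n = \<zero>" using p by (simp add: mem_upD)
    qed auto
    then show ?thesis by (simp add: dp_mult_coeff[OF p q N])
  qed
  then show "\<exists>n. bound \<zero> n (p \<otimes>\<^bsub>diff_poly R \<delta>\<^esub> q)" by (auto simp: bound_def)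
qed

lemma xm_add:
  assumes "p \<in> up R" "q \<in> up R"
  shows "xm (\<lambda>n. p n \<oplus> q n) = (\<lambda>n. xm p n \<oplus> xm q n)"
proof
  fix n
  have c: "p i \<in> carrier R" "q i \<in> carrier R" for i using assms by auto
  show "xm (\<lambda>n. p n \<oplus> q n) n = xm p n \<oplus> xm q n"
    by (cases n) (simp_all add: dp_x_mult_def deriv_add c add.m_ac)
qed

lemma xm_pow_add:
  assumes "p \<in> up R" "q \<in> up R"
  shows "(xm ^^ i) (\<lambda>n. p n \<oplus> q n) = (\<lambda>n. (xm ^^ i) p n \<oplus> (xm ^^ i) q n)"
  by (induction i) (simp_all add: xm_add xm_pow_closed assms)

lemma add_fun: "p \<in> up R \<Longrightarrow> q \<in> up R \<Longrightarrow> p \<oplus>\<^bsub>UP R\<^esub> q = (\<lambda>n. p n \<oplus> q n)"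
  by (simp add: UP_def)

lemma dp_r_distr:
  assumes "p \<in> up R" "q \<in> up R" "r \<in> up R"
  shows "p \<otimes>\<^bsub>diff_poly R \<delta>\<^esub> (q \<oplus>\<^bsub>UP R\<^esub> r)
       = (p \<otimes>\<^bsub>diff_poly R \<delta>\<^esub> q) \<oplus>\<^bsub>UP R\<^esub> (p \<otimes>\<^bsub>diff_poly R \<delta>\<^esub> r)"
proof
  fix n
  obtain N where N: "\<And>i. N < i \<Longrightarrow> p i = \<zero>" using up_bound_ex[OF assms(1)] by blast
  have c: "p i \<in> carrier R" for i using assms by auto
  show "(p \<otimes>\<^bsub>diff_poly R \<delta>\<^esub> (q \<oplus>\<^bsub>UP R\<^esub> r)) n
      = ((p \<otimes>\<^bsub>diff_poly R \<delta>\<^esub> q) \<oplus>\<^bsub>UP R\<^esub> (p \<otimes>\<^bsub>diff_poly R \<delta>\<^esub> r)) n"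
    using assms c
    by (simp add: add_fun dp_mult_closed up_add_closed dp_mult_coeff[OF _ _ N] xm_pow_add
        r_distr finsum_addf Pi_def)
qed

lemma dp_l_distr:
  assumes "p \<in> up R" "q \<in> up R" "r \<in> up R"
  shows "(p \<oplus>\<^bsub>UP R\<^esub> q) \<otimes>\<^bsub>diff_poly R \<delta>\<^esub> r
       = (p \<otimes>\<^bsub>diff_poly R \<delta>\<^esub> r) \<oplus>\<^bsub>UP R\<^esub> (q \<otimes>\<^bsub>diff_poly R \<delta>\<^esub> r)"
proof
  fix n
  obtain N where N: "\<And>i. N < i \<Longrightarrow> p i = \<zero>" using up_bound_ex[OF assms(1)] by blast
  obtain M where M: "\<And>i. M < i \<Longrightarrow> q i = \<zero>" using up_bound_ex[OF assms(2)] by blast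
  have c: "p i \<in> carrier R" "q i \<in> carrier R" for i using assms by auto
  have "((p \<oplus>\<^bsub>UP R\<^esub> q) \<otimes>\<^bsub>diff_poly R \<delta>\<^esub> r) n
      = (\<Oplus>i\<in>{..max N M}. (p i \<oplus> q i) \<otimes> (xm ^^ i) r n)"
    using dp_mult_coeff[of "\<lambda>n. p n \<oplus> q n" r "max N M" n] assms N M
    by (simp add: add_fun up_add_closed)
  also have "\<dots> = (\<Oplus>i\<in>{..max N M}. p i \<otimes> (xm ^^ i) r n)
      \<oplus> (\<Oplus>i\<in>{..max N M}. q i \<otimes> (xm ^^ i) r n)"
    using assms c by (simp add: l_distr finsum_addf Pi_def)
  also have "\<dots> = ((p \<otimes>\<^bsub>diff_poly R \<delta>\<^esub> r) \<oplus>\<^bsub>UP R\<^esub> (q \<otimes>\<^bsub>diff_poly R \<delta>\<^esub> r)) n"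
    using dp_mult_coeff[of p r "max N M" n] dp_mult_coeff[of q r "max N M" n] assms N M
    by (simp add: add_fun dp_mult_closed)
  finally show "((p \<oplus>\<^bsub>UP R\<^esub> q) \<otimes>\<^bsub>diff_poly R \<delta>\<^esub> r) n
      = ((p \<otimes>\<^bsub>diff_poly R \<delta>\<^esub> r) \<oplus>\<^bsub>UP R\<^esub> (q \<otimes>\<^bsub>diff_poly R \<delta>\<^esub> r)) n" .
qed

lemma dp_smult_assoc:
  assumes "a \<in> carrier R" "q \<in> up R" "r \<in> up R"
  shows "(\<lambda>n. a \<otimes> q n) \<otimes>\<^bsub>diff_poly R \<delta>\<^esub> r = (\<lambda>n. a \<otimes> (q \<otimes>\<^bsub>diff_poly R \<delta>\<^esub> r) n)"
proof
  fix n
  obtain N where N: "\<And>i. N < i \<Longrightarrow> q i = \<zero>" using up_bound_ex[OF assms(2)] by blast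
  have c: "q i \<in> carrier R" for i using assms by auto
  have "((\<lambda>n. a \<otimes> q n) \<otimes>\<^bsub>diff_poly R \<delta>\<^esub> r) n = (\<Oplus>i\<in>{..N}. (a \<otimes> q i) \<otimes> (xm ^^ i) r n)"
    using dp_mult_coeff[of "\<lambda>n. a \<otimes> q n" r N n] assms N by (simp add: up_smult_closed)
  also have "\<dots> = a \<otimes> (\<Oplus>i\<in>{..N}. q i \<otimes> (xm ^^ i) r n)"
    using assms c by (simp add: m_assoc finsum_rdistr Pi_def)
  finally show "((\<lambda>n. a \<otimes> q n) \<otimes>\<^bsub>diff_poly R \<delta>\<^esub> r) n = a \<otimes> (q \<otimes>\<^bsub>diff_poly R \<delta>\<^esub> r) n"
    by (simp add: dp_mult_coeff[OF assms(2,3) N])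
qed

lemma dp_xm_assoc:
  assumes "q \<in> up R" "r \<in> up R"
  shows "xm q \<otimes>\<^bsub>diff_poly R \<delta>\<^esub> r = xm (q \<otimes>\<^bsub>diff_poly R \<delta>\<^esub> r)"
proof
  fix n
  obtain N where N: "\<And>i. N < i \<Longrightarrow> q i = \<zero>" using up_bound_ex[OF assms(1)] by blast
  have c: "q i \<in> carrier R" for i using assms by auto
  let ?s = "\<lambda>m. case m of 0 \<Rightarrow> \<zero> | Suc k \<Rightarrow> q k"
  let ?y = "\<lambda>i n. (xm ^^ i) r n"
  have sc: "?s i \<in> carrier R" for i using c by (cases i) auto
  have bd: "xm q i = \<zero>" if "Suc N < i" for i
    using that N by (cases i) (auto simp: dp_x_mult_def)
  have "(xm q \<otimes>\<^bsub>diff_poly R \<delta>\<^esub> r) n = (\<Oplus>i\<in>{..Suc N}. (?s i \<oplus> \<delta> (q i)) \<otimes> ?y i n)"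
    using dp_mult_coeff[OF xm_closed[OF assms(1)] assms(2) bd, of "Suc N" n]
    by (simp add: dp_x_mult_def)
  also have "\<dots> = (\<Oplus>i\<in>{..Suc N}. ?s i \<otimes> ?y i n) \<oplus> (\<Oplus>i\<in>{..Suc N}. \<delta> (q i) \<otimes> ?y i n)"
    using assms c sc by (simp add: l_distr finsum_addf Pi_def del: finsum_Suc)
  also have "(\<Oplus>i\<in>{..Suc N}. ?s i \<otimes> ?y i n) = (\<Oplus>i\<in>{..N}. q i \<otimes> ?y (Suc i) n)"
  proof -
    have "(\<Oplus>i\<in>{..N}. q i \<otimes> ?y (Suc i) n) \<in> carrier R"
      using c xm_pow_coeff_closed[OF assms(2)] by (intro finsum_closed Pi_I m_closed)
    moreover have "?s i \<otimes> ?y i n \<in> carrier R" for i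
      using sc xm_pow_coeff_closed[OF assms(2)] by (intro m_closed)
    moreover have "r n \<in> carrier R" using assms by auto
    ultimately show ?thesis
      by (subst finsum_Suc2) (simp_all del: funpow.simps add: Pi_def)
  qed
  also have "(\<Oplus>i\<in>{..Suc N}. \<delta> (q i) \<otimes> ?y i n) = (\<Oplus>i\<in>{..N}. \<delta> (q i) \<otimes> ?y i n)"
    using assms c N by (simp add: finsum_Suc Pi_def del: funpow.simps)
  also have "(\<Oplus>i\<in>{..N}. q i \<otimes> ?y (Suc i) n)
      = (\<Oplus>i\<in>{..N}. q i \<otimes> (case n of 0 \<Rightarrow> \<zero> | Suc k \<Rightarrow> ?y i k)) \<oplus> (\<Oplus>i\<in>{..N}. q i \<otimes> \<delta> (?y i n))"
  proof -
    have "(case n of 0 \<Rightarrow> \<zero> | Suc k \<Rightarrow> ?y i k) \<in> carrier R" for i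
      using assms by (cases n) auto
    then show ?thesis
      using assms c
      by (subst finsum_addf[symmetric]) (auto simp: dp_x_mult_def r_distr)
  qed
  also have "(\<Oplus>i\<in>{..N}. q i \<otimes> (case n of 0 \<Rightarrow> \<zero> | Suc k \<Rightarrow> ?y i k))
      = (case n of 0 \<Rightarrow> \<zero> | Suc k \<Rightarrow> (q \<otimes>\<^bsub>diff_poly R \<delta>\<^esub> r) k)"
    using c by (cases n) (simp_all add: dp_mult_coeff[OF assms N])
  finally have L: "(xm q \<otimes>\<^bsub>diff_poly R \<delta>\<^esub> r) n
      = (case n of 0 \<Rightarrow> \<zero> | Suc k \<Rightarrow> (q \<otimes>\<^bsub>diff_poly R \<delta>\<^esub> r) k)
        \<oplus> (\<Oplus>i\<in>{..N}. q i \<otimes> \<delta> (?y i n)) \<oplus> (\<Oplus>i\<in>{..N}. \<delta> (q i) \<otimes> ?y i n)" .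
  have "\<delta> ((q \<otimes>\<^bsub>diff_poly R \<delta>\<^esub> r) n) = (\<Oplus>i\<in>{..N}. \<delta> (q i \<otimes> ?y i n))"
    using assms c by (simp add: dp_mult_coeff[OF assms N] deriv_finsum Pi_def)
  also have "\<dots> = (\<Oplus>i\<in>{..N}. \<delta> (q i) \<otimes> ?y i n) \<oplus> (\<Oplus>i\<in>{..N}. q i \<otimes> \<delta> (?y i n))"
    using assms c by (simp add: deriv_mult finsum_addf Pi_def)
  finally have D: "\<delta> ((q \<otimes>\<^bsub>diff_poly R \<delta>\<^esub> r) n)
      = (\<Oplus>i\<in>{..N}. \<delta> (q i) \<otimes> ?y i n) \<oplus> (\<Oplus>i\<in>{..N}. q i \<otimes> \<delta> (?y i n))" .
  have "(case n of 0 \<Rightarrow> \<zero> | Suc k \<Rightarrow> (q \<otimes>\<^bsub>diff_poly R \<delta>\<^esub> r) k) \<in> carrier R"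
    using dp_mult_closed[OF assms] by (cases n) auto
  moreover have "(\<Oplus>i\<in>{..N}. \<delta> (q i) \<otimes> ?y i n) \<in> carrier R"
    "(\<Oplus>i\<in>{..N}. q i \<otimes> \<delta> (?y i n)) \<in> carrier R"
    using assms c by (auto intro!: finsum_closed)
  ultimately show "(xm q \<otimes>\<^bsub>diff_poly R \<delta>\<^esub> r) n = xm (q \<otimes>\<^bsub>diff_poly R \<delta>\<^esub> r) n"
    unfolding L dp_x_mult_def[of R \<delta> "q \<otimes>\<^bsub>diff_poly R \<delta>\<^esub> r"] D
    by (simp add: add.m_ac)
qed

lemma dp_xm_pow_assoc:
  assumes "q \<in> up R" "r \<in> up R"
  shows "(xm ^^ i) q \<otimes>\<^bsub>diff_poly R \<delta>\<^esub> r = (xm ^^ i) (q \<otimes>\<^bsub>diff_poly R \<delta>\<^esub> r)"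
  by (induction i) (simp_all add: dp_xm_assoc xm_pow_closed assms)

lemma dp_m_assoc:
  assumes "p \<in> up R" "q \<in> up R" "r \<in> up R"
  shows "(p \<otimes>\<^bsub>diff_poly R \<delta>\<^esub> q) \<otimes>\<^bsub>diff_poly R \<delta>\<^esub> r
       = p \<otimes>\<^bsub>diff_poly R \<delta>\<^esub> (q \<otimes>\<^bsub>diff_poly R \<delta>\<^esub> r)"
proof -
  have c: "p i \<in> carrier R" for i using assms by auto
  have sumc: "(\<lambda>n. \<Oplus>i\<in>{..N}. p i \<otimes> (xm ^^ i) s n) \<in> up R" if "s \<in> up R" for s and N :: nat
  proof (induction N)
    case 0
    then show ?case
      using up_smult_closed[OF c that, of 0] that c by (simp add: mem_upD)
  next
    case (Suc N)
    have "(\<lambda>n. p (Suc N) \<otimes> (xm ^^ Suc N) s n \<oplus> (\<Oplus>i\<in>{..N}. p i \<otimes> (xm ^^ i) s n)) \<in> up R"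
      using that c Suc xm_pow_closed[OF that, of "Suc N"]
      by (intro up_add_closed up_smult_closed) auto
    moreover have "(\<Oplus>i\<in>{..Suc N}. p i \<otimes> (xm ^^ i) s n)
        = p (Suc N) \<otimes> (xm ^^ Suc N) s n \<oplus> (\<Oplus>i\<in>{..N}. p i \<otimes> (xm ^^ i) s n)" for n
      using that c xm_pow_coeff_closed[OF that]
      by (subst finsum_Suc) (auto simp del: funpow.simps)
    ultimately show ?case by presburger
  qed
  have key: "(\<lambda>n. \<Oplus>i\<in>{..N}. p i \<otimes> (xm ^^ i) q n) \<otimes>\<^bsub>diff_poly R \<delta>\<^esub> r
      = (\<lambda>n. \<Oplus>i\<in>{..N}. p i \<otimes> (xm ^^ i) (q \<otimes>\<^bsub>diff_poly R \<delta>\<^esub> r) n)" for N :: nat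
  proof (induction N)
    case 0
    then show ?case
      using assms c by (simp add: dp_smult_assoc dp_mult_closed mem_upD)
  next
    case (Suc N)
    have e: "(\<lambda>n. \<Oplus>i\<in>{..Suc N}. p i \<otimes> (xm ^^ i) s n)
        = (\<lambda>n. p (Suc N) \<otimes> (xm ^^ Suc N) s n) \<oplus>\<^bsub>UP R\<^esub> (\<lambda>n. \<Oplus>i\<in>{..N}. p i \<otimes> (xm ^^ i) s n)"
      if "s \<in> up R" for s
      using that c xm_pow_coeff_closed[OF that] sumc[OF that, of N]
        up_smult_closed[OF c[of "Suc N"] xm_pow_closed[OF that, of "Suc N"]]
      by (subst add_fun) (auto simp del: funpow.simps intro!: finsum_Suc)
    have up: "(\<lambda>n. p (Suc N) \<otimes> (xm ^^ Suc N) s n) \<in> up R" if "s \<in> up R" for s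
      by (intro up_smult_closed c xm_pow_closed that)
    show ?case
      unfolding e[OF assms(2)] e[OF dp_mult_closed[OF assms(2,3)]]
      by (subst dp_l_distr[OF up[OF assms(2)] sumc[OF assms(2)] assms(3)])
        (simp only: Suc.IH dp_smult_assoc[OF c xm_pow_closed[OF assms(2)] assms(3)]
          dp_xm_pow_assoc[OF assms(2,3)])
  qed
  obtain N where N: "\<And>i. N < i \<Longrightarrow> p i = \<zero>" using up_bound_ex[OF assms(1)] by blast
  have "p \<otimes>\<^bsub>diff_poly R \<delta>\<^esub> q = (\<lambda>n. \<Oplus>i\<in>{..N}. p i \<otimes> (xm ^^ i) q n)"
    using dp_mult_coeff[OF assms(1,2) N] by auto
  moreover have "p \<otimes>\<^bsub>diff_poly R \<delta>\<^esub> (q \<otimes>\<^bsub>diff_poly R \<delta>\<^esub> r)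
      = (\<lambda>n. \<Oplus>i\<in>{..N}. p i \<otimes> (xm ^^ i) (q \<otimes>\<^bsub>diff_poly R \<delta>\<^esub> r) n)"
    using dp_mult_coeff[OF assms(1) dp_mult_closed[OF assms(2,3)] N] by auto
  ultimately show ?thesis using key by simp
qed

lemma monom_fun: "a \<in> carrier R \<Longrightarrow> monom (UP R) a n = (\<lambda>i. if i = n then a else \<zero>)"
  by (simp add: UP_def)

lemma monom_up: "a \<in> carrier R \<Longrightarrow> monom (UP R) a n \<in> up R"
  using UP_ring.monom_closed[OF UP_ring_R, of a n] by (simp add: UP_carrier)

lemma dp_monom_mult:
  assumes "a \<in> carrier R" "q \<in> up R"
  shows "monom (UP R) a k \<otimes>\<^bsub>diff_poly R \<delta>\<^esub> q = (\<lambda>n. a \<otimes> (xm ^^ k) q n)"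
proof
  fix n
  have "(monom (UP R) a k \<otimes>\<^bsub>diff_poly R \<delta>\<^esub> q) n
      = (\<Oplus>i\<in>{..k}. (if i = k then a else \<zero>) \<otimes> (xm ^^ i) q n)"
    using dp_mult_coeff[OF monom_up[OF assms(1)] assms(2), of k k n] assms
    by (simp add: monom_fun)
  also have "\<dots> = (\<Oplus>i\<in>{..k}. if k = i then a \<otimes> (xm ^^ i) q n else \<zero>)"
    using assms by (intro finsum_cong') auto
  also have "\<dots> = a \<otimes> (xm ^^ k) q n"
    using assms by (subst finsum_singleton) auto
  finally show "(monom (UP R) a k \<otimes>\<^bsub>diff_poly R \<delta>\<^esub> q) n = a \<otimes> (xm ^^ k) q n" .
qed

lemma xm_pow_monom_one: "(xm ^^ k) (monom (UP R) \<one> j) = monom (UP R) \<one> (j + k)"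
proof (induction k)
  case (Suc k)
  have "xm (monom (UP R) \<one> m) = monom (UP R) \<one> (Suc m)" for m
    by (auto simp: dp_x_mult_def monom_fun split: nat.split)
  with Suc show ?case by simp
qed simp

lemma UP_one_monom: "\<one>\<^bsub>UP R\<^esub> = monom (UP R) \<one> 0"
  by (simp add: UP_def)

theorem dp_ring: "ring (diff_poly R \<delta>)"
proof (rule ringI)
  interpret P: ring "UP R" by (rule UP_ring.UP_ring[OF UP_ring_R])
  have "comm_group (add_monoid (UP R))" by (rule abelian_group.a_comm_group[OF P.is_abelian_group])
  then have cg: "comm_group (add_monoid (diff_poly R \<delta>))"
    by (simp only: diff_poly_add_monoid)
  show "abelian_group (diff_poly R \<delta>)"
    by (rule abelian_group.intro[OF abelian_monoid.intro[OF comm_group.axioms(1)[OF cg]]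
          abelian_group_axioms.intro[OF cg]])
  show "monoid (diff_poly R \<delta>)"
  proof (rule monoidI)
    fix p assume "p \<in> carrier (diff_poly R \<delta>)"
    then have p: "p \<in> up R" by simp
    show "\<one>\<^bsub>diff_poly R \<delta>\<^esub> \<otimes>\<^bsub>diff_poly R \<delta>\<^esub> p = p"
      using p by (auto simp: UP_one_monom dp_monom_mult mem_upD)
    show "p \<otimes>\<^bsub>diff_poly R \<delta>\<^esub> \<one>\<^bsub>diff_poly R \<delta>\<^esub> = p"
    proof
      fix n
      obtain N where N: "\<And>i. N < i \<Longrightarrow> p i = \<zero>" using up_bound_ex[OF p] by blast
      have N': "max N n < i \<Longrightarrow> p i = \<zero>" for i using N by simp
      have c: "p i \<in> carrier R" for i using p by auto
      have "(p \<otimes>\<^bsub>diff_poly R \<delta>\<^esub> \<one>\<^bsub>diff_poly R \<delta>\<^esub>) n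
          = (\<Oplus>i\<in>{..max N n}. p i \<otimes> (if n = i then \<one> else \<zero>))"
        using dp_mult_coeff[of p "monom (UP R) \<one> 0" "max N n" n, OF p monom_up[OF one_closed] N']
        by (simp only: diff_poly_simps UP_one_monom xm_pow_monom_one) (simp add: monom_fun)
      also have "\<dots> = (\<Oplus>i\<in>{..max N n}. if n = i then p i else \<zero>)"
        using c by (intro finsum_cong') auto
      also have "\<dots> = p n"
        using c by (subst finsum_singleton) auto
      finally show "(p \<otimes>\<^bsub>diff_poly R \<delta>\<^esub> \<one>\<^bsub>diff_poly R \<delta>\<^esub>) n = p n" .
    qed
  qed (simp_all add: dp_mult_closed dp_m_assoc UP_one_monom monom_up)
qed (simp_all add: dp_l_distr dp_r_distr)

theorem dp_monom_one_mult:
  "monom (diff_poly R \<delta>) \<one> i \<otimes>\<^bsub>diff_poly R \<delta>\<^esub> monom (diff_poly R \<delta>) \<one> j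
     = monom (diff_poly R \<delta>) \<one> (i + j)"
  by (simp add: dp_monom_mult monom_up xm_pow_monom_one)
    (simp add: monom_fun add.commute if_distrib cong: if_cong)

lemma dp_x_pow: "dp_x R \<delta> [^]\<^bsub>diff_poly R \<delta>\<^esub> (i::nat) = monom (diff_poly R \<delta>) \<one> i"
proof (induction i)
  case 0
  then show ?case by (simp add: UP_one_monom)
next
  case (Suc i)
  then show ?case using dp_monom_one_mult[of i 1] by (simp add: dp_x_def)
qed

lemma dp_const_mult:
  "a \<in> carrier R \<Longrightarrow> p \<in> up R \<Longrightarrow>
     dp_const R \<delta> a \<otimes>\<^bsub>diff_poly R \<delta>\<^esub> p = a \<odot>\<^bsub>diff_poly R \<delta>\<^esub> p"
  by (simp add: dp_const_def dp_monom_mult) (simp add: UP_def)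

theorem dp_const_mult_x_pow:
  "a \<in> carrier R \<Longrightarrow>
     dp_const R \<delta> a \<otimes>\<^bsub>diff_poly R \<delta>\<^esub> dp_x R \<delta> [^]\<^bsub>diff_poly R \<delta>\<^esub> (i::nat) = monom (diff_poly R \<delta>) a i"
  by (simp add: dp_x_pow dp_const_def dp_monom_mult monom_up)
    (simp add: monom_fun if_distrib cong: if_cong)

theorem dp_x_mult_const:
  assumes "r \<in> carrier R"
  shows "dp_x R \<delta> \<otimes>\<^bsub>diff_poly R \<delta>\<^esub> dp_const R \<delta> r
       = (dp_const R \<delta> r \<otimes>\<^bsub>diff_poly R \<delta>\<^esub> dp_x R \<delta>) \<oplus>\<^bsub>diff_poly R \<delta>\<^esub> dp_const R \<delta> (\<delta> r)"
proof -
  have "dp_const R \<delta> r \<otimes>\<^bsub>diff_poly R \<delta>\<^esub> dp_x R \<delta> = monom (UP R) r 1"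
    using dp_monom_mult[OF assms monom_up[OF one_closed], of 0 1] assms
    by (simp add: dp_const_def dp_x_def monom_fun if_distrib cong: if_cong)
  moreover have "xm (monom (UP R) r 0) n \<in> carrier R" for n
    using xm_closed[OF monom_up[OF assms]] by auto
  ultimately show ?thesis
    using assms
    by (auto simp: dp_x_def dp_const_def dp_monom_mult monom_up add_fun)
      (auto simp: monom_fun dp_x_mult_def split: nat.split)
qed

lemma dp_const_hom: "dp_const R \<delta> \<in> ring_hom R (diff_poly R \<delta>)"
proof (rule ring_hom_memI)
  fix a b assume ab: "a \<in> carrier R" "b \<in> carrier R"
  show "dp_const R \<delta> (a \<otimes> b) = dp_const R \<delta> a \<otimes>\<^bsub>diff_poly R \<delta>\<^esub> dp_const R \<delta> b"
    using ab by (simp add: dp_const_def dp_monom_mult monom_up) (auto simp: monom_fun)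
  show "dp_const R \<delta> (a \<oplus> b) = dp_const R \<delta> a \<oplus>\<^bsub>diff_poly R \<delta>\<^esub> dp_const R \<delta> b"
    using ab by (simp add: dp_const_def monom_up add_fun) (auto simp: monom_fun)
qed (simp_all add: dp_const_def monom_up UP_one_monom)

theorem dp_filtration_eq: "dp_filtration R \<delta> n = {p \<in> up R. \<forall>i>n. p i = \<zero>}"
proof -
  have fs: "(\<Oplus>\<^bsub>UP R\<^esub>i\<in>{..n}. monom (UP R) (a i) i) = (\<lambda>i. if i \<le> n then a i else \<zero>)"
    if "a \<in> {..n} \<rightarrow> carrier R" for a
    using that
  proof (induction n)
    case 0
    interpret P: ring "UP R" by (rule UP_ring.UP_ring[OF UP_ring_R])
    from 0 have "monom (UP R) (a 0) 0 \<in> carrier (UP R)" by (simp add: UP_carrier monom_up)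
    with 0 show ?case by simp (auto simp: monom_fun)
  next
    case (Suc n)
    then have a: "a \<in> {..n} \<rightarrow> carrier R" "a (Suc n) \<in> carrier R" by auto
    interpret P: ring "UP R" by (rule UP_ring.UP_ring[OF UP_ring_R])
    have up: "(\<lambda>i. if i \<le> n then a i else \<zero>) \<in> up R"
      using a by (auto simp: bound_def intro!: mem_upI exI[of _ n])
    have "(\<Oplus>\<^bsub>UP R\<^esub>i\<in>{..Suc n}. monom (UP R) (a i) i)
        = monom (UP R) (a (Suc n)) (Suc n) \<oplus>\<^bsub>UP R\<^esub> (\<Oplus>\<^bsub>UP R\<^esub>i\<in>{..n}. monom (UP R) (a i) i)"
      unfolding atMost_Suc
      using Suc.prems by (intro P.finsum_insert) (auto simp: UP_carrier intro!: monom_up)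
    then show ?case
      using Suc.IH[OF a(1)] a up by (auto simp: add_fun monom_up) (auto simp: monom_fun le_Suc_eq Pi_def)
  qed
  have cg: "(\<Oplus>\<^bsub>diff_poly R \<delta>\<^esub>i\<in>{..n}. dp_const R \<delta> (a i) \<otimes>\<^bsub>diff_poly R \<delta>\<^esub> dp_x R \<delta> [^]\<^bsub>diff_poly R \<delta>\<^esub> i)
      = (\<lambda>i. if i \<le> n then a i else \<zero>)" if "a \<in> {..n} \<rightarrow> carrier R" for a
  proof -
    interpret S: ring "diff_poly R \<delta>" by (rule dp_ring)
    have "(\<Oplus>\<^bsub>diff_poly R \<delta>\<^esub>i\<in>{..n}. dp_const R \<delta> (a i) \<otimes>\<^bsub>diff_poly R \<delta>\<^esub> dp_x R \<delta> [^]\<^bsub>diff_poly R \<delta>\<^esub> i)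
       = (\<Oplus>\<^bsub>diff_poly R \<delta>\<^esub>i\<in>{..n}. monom (UP R) (a i) i)"
      using that dp_const_mult_x_pow by (intro S.finsum_cong') (auto simp: monom_up Pi_def)
    then show ?thesis using fs[OF that] by (simp add: diff_poly_finsum)
  qed
  show ?thesis
  proof (intro equalityI subsetI)
    fix p assume "p \<in> dp_filtration R \<delta> n"
    then obtain a where "a \<in> {..n} \<rightarrow> carrier R" "p = (\<lambda>i. if i \<le> n then a i else \<zero>)"
      unfolding dp_filtration_def using cg by blast
    then show "p \<in> {p \<in> up R. \<forall>i>n. p i = \<zero>}"
      by (auto simp: bound_def Pi_def intro!: mem_upI exI[of _ n])
  next
    fix p assume p: "p \<in> {p \<in> up R. \<forall>i>n. p i = \<zero>}"
    then have "p \<in> {..n} \<rightarrow> carrier R" "p = (\<lambda>i. if i \<le> n then p i else \<zero>)" by auto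
    with cg[of p] show "p \<in> dp_filtration R \<delta> n"
      unfolding dp_filtration_def by (intro CollectI exI[of _ p]) simp
  qed
qed

end

end

theory Submission
  imports Defs "HOL-Algebra.Multiplicative_Group"
begin

text \<open>
  The key point: if \<open>R\<close> is simple of characteristic zero and \<open>\<delta>\<close> is outer, a sub-bimodule containing an
  element of degree \<open>d\<close> contains all polynomials of degree at most \<open>d\<close>. The leading coefficients of its
  elements of degree at most \<open>d\<close> form an ideal of \<open>R\<close>, so it contains a monic \<open>m\<close> of degree \<open>d\<close>; the
  \<open>x\<^bsup>d-1\<^esup>\<close>-coefficient of \<open>m r - r m\<close> is \<open>d \<delta>(r) + m\<^bsub>d-1\<^esub> r - r m\<^bsub>d-1\<^esub>\<close>, which cannot vanish for all \<open>r\<close>,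
  and one descends. Conversely, if \<open>\<delta>\<close> is the inner derivation given by \<open>a\<close>, then \<open>x - a\<close> is a central
  non-unit, which contradicts both the simplicity of \<open>R[x;\<delta>]\<close> and \<open>C\<^sub>S(R) = Z(R)\<close>.
\<close>

section \<open>Closure criteria, characteristic and simplicity in general rings\<close>

lemma (in abelian_group) diff_add_cancel_carrier:
  "a \<in> carrier G \<Longrightarrow> b \<in> carrier G \<Longrightarrow> (a \<ominus> b) \<oplus> b = a"
  by (simp add: a_minus_def a_assoc l_neg)

text \<open>Negation is left multiplication by minus one, so closure under this product replaces
  closure under inverses; for ideals and sub-bimodules it is an instance of absorption.\<close>

lemma (in ring) additive_subgroup_minus_oneI:
  assumes "M \<subseteq> carrier R" "\<zero> \<in> M" "\<And>a b. a \<in> M \<Longrightarrow> b \<in> M \<Longrightarrow> a \<oplus> b \<in> M"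
    and "\<And>a. a \<in> M \<Longrightarrow> (\<ominus> \<one>) \<otimes> a \<in> M"
  shows "additive_subgroup M R"
proof (rule additive_subgroupI, rule add.subgroupI)
  fix a assume a: "a \<in> M"
  then have "(\<ominus> \<one>) \<otimes> a = \<ominus> a"
    using assms(1) by (auto simp: l_minus)
  then show "\<ominus> a \<in> M"
    using assms(4)[OF a] by simp
qed (use assms in auto)

lemma (in ring) ideal_mult_closedI:
  assumes "M \<subseteq> carrier R" "\<zero> \<in> M" "\<And>a b. a \<in> M \<Longrightarrow> b \<in> M \<Longrightarrow> a \<oplus> b \<in> M"
    and "\<And>a r. a \<in> M \<Longrightarrow> r \<in> carrier R \<Longrightarrow> r \<otimes> a \<in> M"
    and "\<And>a r. a \<in> M \<Longrightarrow> r \<in> carrier R \<Longrightarrow> a \<otimes> r \<in> M"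
  shows "ideal M R"
proof (rule idealI[OF ring_axioms])
  show "subgroup M (add_monoid R)"
    using additive_subgroup_minus_oneI[OF assms(1-3)] assms(4)
    by (simp add: additive_subgroup.a_subgroup)
qed (use assms in auto)

text \<open>\<open>LEAST\<close> returns a positive number whenever some positive multiple of one
  vanishes, so the value 0 comes only from the default branch.\<close>

lemma ring_characteristic_eq_0_iff:
  "ring_characteristic R = 0 \<longleftrightarrow> (\<forall>n::nat. 0 < n \<longrightarrow> [n] \<cdot>\<^bsub>R\<^esub> \<one>\<^bsub>R\<^esub> \<noteq> \<zero>\<^bsub>R\<^esub>)"
  unfolding ring_characteristic_def by (smt (verit) LeastI_ex less_irrefl)

lemma simple_ring_ideal_eq_carrier:
  "simple_ring R \<Longrightarrow> ideal I R \<Longrightarrow> a \<in> I \<Longrightarrow> a \<noteq> \<zero>\<^bsub>R\<^esub> \<Longrightarrow> I = carrier R"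
  unfolding simple_ring_def by blast

section \<open>Coefficients of products with constants\<close>

context ring_derivation
begin

abbreviation S where "S \<equiv> diff_poly R \<delta>"

sublocale S: ring S
  by (rule dp_ring)

lemma zero_fun: "\<zero>\<^bsub>UP R\<^esub> = (\<lambda>i. \<zero>)"
  by (simp add: UP_def)

text \<open>The support is finite and nonempty, so it has a greatest index. Degree bounds are
  expressed from here on as vanishing of all coefficients above d instead of through
  \<open>deg\<close>.\<close>

lemma up_nonzero_leading:
  assumes "p \<in> up R" "p \<noteq> \<zero>\<^bsub>UP R\<^esub>"
  obtains d where "p d \<noteq> \<zero>" "\<And>i. d < i \<Longrightarrow> p i = \<zero>"
proof -
  obtain N where N: "\<And>i. N < i \<Longrightarrow> p i = \<zero>" using up_bound_ex[OF assms(1)] by blast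
  obtain k where k: "p k \<noteq> \<zero>" using assms(2) by (auto simp: zero_fun)
  have b: "i \<le> N" if "p i \<noteq> \<zero>" for i using N[of i] that by (meson not_less)
  show ?thesis
    using GreatestI_nat[of "\<lambda>i. p i \<noteq> \<zero>", OF k b] Greatest_le_nat[of "\<lambda>i. p i \<noteq> \<zero>" _ N] b
    by (intro that[of "GREATEST i. p i \<noteq> \<zero>"]) (blast, meson not_less)
qed

text \<open>Reduced to the pointwise formula for addition: adding q back to the difference returns
  p.\<close>

lemma minus_coeff:
  assumes "p \<in> up R" "q \<in> up R"
  shows "(p \<ominus>\<^bsub>S\<^esub> q) n = p n \<ominus> q n"
proof -
  have "p = (p \<ominus>\<^bsub>S\<^esub> q) \<oplus>\<^bsub>S\<^esub> q"
    using assms S.diff_add_cancel_carrier[of p q] by simp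
  moreover have d: "p \<ominus>\<^bsub>S\<^esub> q \<in> up R" using assms S.minus_closed[of p q] by simp
  ultimately have "p n = (p \<ominus>\<^bsub>S\<^esub> q) n \<oplus> q n"
    using add_fun[OF d assms(2)] by (metis diff_poly_simps(4))
  moreover have "p n \<in> carrier R" "q n \<in> carrier R" "(p \<ominus>\<^bsub>S\<^esub> q) n \<in> carrier R"
    using assms d by auto
  ultimately show ?thesis
    by (simp add: a_minus_def a_assoc r_neg)
qed

lemma dp_const_fun: "a \<in> carrier R \<Longrightarrow> dp_const R \<delta> a = (\<lambda>i. if i = 0 then a else \<zero>)"
  by (simp add: dp_const_def monom_fun)

lemma dp_const_closed [simp, intro]: "a \<in> carrier R \<Longrightarrow> dp_const R \<delta> a \<in> up R"
  by (simp add: dp_const_def monom_up)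

lemma dp_const_mult_coeff:
  "a \<in> carrier R \<Longrightarrow> p \<in> up R \<Longrightarrow> (dp_const R \<delta> a \<otimes>\<^bsub>S\<^esub> p) n = a \<otimes> p n"
  by (simp add: dp_const_def dp_monom_mult)

text \<open>For a constant q = r this is the Pascal recursion for the coefficients of
  \<open>x^i r\<close>, which are binom(i,n) times the (i-n)-th derivative of r. The next lemmas
  evaluate them for n > i, n = i and n = i - 1.\<close>

lemma xm_pow_Suc_Suc:
  "(xm ^^ Suc i) q (Suc n) = (xm ^^ i) q n \<oplus> \<delta> ((xm ^^ i) q (Suc n))"
  by (simp add: dp_x_mult_def)

lemma xm_pow_const_above:
  "r \<in> carrier R \<Longrightarrow> i < n \<Longrightarrow> (xm ^^ i) (dp_const R \<delta> r) n = \<zero>"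
  using xm_pow_bound[OF dp_const_closed, of r 0 i n] by (simp add: dp_const_fun)

lemma xm_pow_const_diag:
  "r \<in> carrier R \<Longrightarrow> (xm ^^ i) (dp_const R \<delta> r) i = r"
proof (induction i)
  case (Suc i)
  then show ?case
    using xm_pow_const_above[of r i "Suc i"] by (simp add: xm_pow_Suc_Suc del: funpow.simps)
qed (simp add: dp_const_fun)

text \<open>Moving \<open>Suc k\<close> factors x past r and losing one degree means that exactly
  one of them acts as \<open>\<delta>\<close>; each of them contributes one summand
  \<open>\<delta> r\<close>.\<close>

lemma xm_pow_const_subdiag:
  "r \<in> carrier R \<Longrightarrow> (xm ^^ Suc k) (dp_const R \<delta> r) k = [Suc k] \<cdot> \<delta> r"
proof (induction k)
  case 0
  then show ?case by (simp add: dp_x_mult_def dp_const_fun)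
next
  case (Suc k)
  then show ?case
    using xm_pow_const_diag[OF Suc.prems, of "Suc k"]
    by (simp add: xm_pow_Suc_Suc del: funpow.simps)
qed

lemma dp_mult_const_coeff:
  assumes "p \<in> up R" "r \<in> carrier R" "\<And>i. d < i \<Longrightarrow> p i = \<zero>"
  shows "(p \<otimes>\<^bsub>S\<^esub> dp_const R \<delta> r) n = (\<Oplus>i\<in>{..d}. p i \<otimes> (xm ^^ i) (dp_const R \<delta> r) n)"
  by (rule dp_mult_coeff) (use assms in auto)

lemma mult_const_above:
  assumes "p \<in> up R" "r \<in> carrier R" "\<And>i. d < i \<Longrightarrow> p i = \<zero>" "d < n"
  shows "(p \<otimes>\<^bsub>S\<^esub> dp_const R \<delta> r) n = \<zero>"
proof -
  have "(p \<otimes>\<^bsub>S\<^esub> dp_const R \<delta> r) n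
      = (\<Oplus>i\<in>{..d}. p i \<otimes> (xm ^^ i) (dp_const R \<delta> r) n)"
    by (rule dp_mult_const_coeff) (use assms in auto)
  also have "\<dots> = (\<Oplus>i\<in>{..d}. \<zero>)"
    using assms by (intro finsum_cong') (auto simp: xm_pow_const_above mem_upD)
  finally show ?thesis by simp
qed

lemma mult_const_leading:
  assumes "p \<in> up R" "r \<in> carrier R" "\<And>i. d < i \<Longrightarrow> p i = \<zero>"
  shows "(p \<otimes>\<^bsub>S\<^esub> dp_const R \<delta> r) d = p d \<otimes> r"
proof -
  have "(p \<otimes>\<^bsub>S\<^esub> dp_const R \<delta> r) d
      = (\<Oplus>i\<in>{..d}. p i \<otimes> (xm ^^ i) (dp_const R \<delta> r) d)"
    by (rule dp_mult_const_coeff) (use assms in auto)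
  also have "\<dots> = (\<Oplus>i\<in>{..d}. if d = i then p i \<otimes> r else \<zero>)"
    using assms
    by (intro finsum_cong') (auto simp: xm_pow_const_above xm_pow_const_diag mem_upD)
  finally show ?thesis
    using assms finsum_singleton[of d "{..d}" "\<lambda>i. p i \<otimes> r"] by (auto simp: mem_upD)
qed

text \<open>Only the indices k and \<open>Suc k\<close> contribute, because \<open>x^i r\<close> has
  degree at most i. The multiple of \<open>\<delta> r\<close> is what the derivation adds to the
  commutator of p with r one step below the top degree.\<close>

lemma mult_const_subleading:
  assumes p: "p \<in> up R" and r: "r \<in> carrier R" and b: "\<And>i. Suc k < i \<Longrightarrow> p i = \<zero>"
  shows "(p \<otimes>\<^bsub>S\<^esub> dp_const R \<delta> r) k = p (Suc k) \<otimes> [Suc k] \<cdot> \<delta> r \<oplus> p k \<otimes> r"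
proof -
  let ?f = "\<lambda>i. p i \<otimes> (xm ^^ i) (dp_const R \<delta> r) k"
  have c: "?f i \<in> carrier R" for i using p r by (auto simp: mem_upD)
  have "(\<Oplus>i\<in>{..k}. ?f i) = (\<Oplus>i\<in>{..k}. if k = i then p i \<otimes> r else \<zero>)"
    using p r
    by (intro finsum_cong') (auto simp: xm_pow_const_above xm_pow_const_diag mem_upD)
  also have "\<dots> = p k \<otimes> r"
    using p r finsum_singleton[of k "{..k}" "\<lambda>i. p i \<otimes> r"] by (auto simp: mem_upD)
  finally have lower: "(\<Oplus>i\<in>{..k}. ?f i) = p k \<otimes> r" .
  have "(p \<otimes>\<^bsub>S\<^esub> dp_const R \<delta> r) k = (\<Oplus>i\<in>{..Suc k}. ?f i)"
    by (rule dp_mult_const_coeff) (use p r b in auto)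
  also have "\<dots> = ?f (Suc k) \<oplus> (\<Oplus>i\<in>{..k}. ?f i)"
    using c by (intro finsum_Suc) blast
  finally show ?thesis
    by (simp only: lower xm_pow_const_subdiag[OF r])
qed

section \<open>Sub-bimodules and their leading coefficients\<close>

lemma subbimoduleI:
  assumes "M \<subseteq> up R" "\<zero>\<^bsub>UP R\<^esub> \<in> M"
    and add: "\<And>p q. p \<in> M \<Longrightarrow> q \<in> M \<Longrightarrow> p \<oplus>\<^bsub>UP R\<^esub> q \<in> M"
    and left: "\<And>r p. r \<in> carrier R \<Longrightarrow> p \<in> M \<Longrightarrow> dp_const R \<delta> r \<otimes>\<^bsub>S\<^esub> p \<in> M"
    and right: "\<And>r p. r \<in> carrier R \<Longrightarrow> p \<in> M \<Longrightarrow> p \<otimes>\<^bsub>S\<^esub> dp_const R \<delta> r \<in> M"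
  shows "dp_subbimodule R \<delta> M"
proof -
  interpret h: ring_hom_ring R S "dp_const R \<delta>"
    by (rule ring_hom_ringI2[OF ring_axioms dp_ring dp_const_hom])
  have "(\<ominus>\<^bsub>S\<^esub> \<one>\<^bsub>S\<^esub>) \<otimes>\<^bsub>S\<^esub> p \<in> M" if "p \<in> M" for p
    \<comment> \<open>The embedding of constants is a ring homomorphism, so minus one of
      \<open>S\<close> is the constant minus one, and left closure yields additive inverses.\<close>
    using left[OF a_inv_closed[OF one_closed] that] h.hom_a_inv[OF one_closed] h.hom_one by simp
  then have "additive_subgroup M S"
    using assms by (intro S.additive_subgroup_minus_oneI) auto
  then show ?thesis
    using left right by (simp add: dp_subbimodule_def)
qed

lemma ideal_is_subbimodule:
  assumes "ideal I S"
  shows "dp_subbimodule R \<delta> I"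
proof -
  interpret I: ideal I S by fact
  show ?thesis
    unfolding dp_subbimodule_def
    using I.is_additive_subgroup I.I_l_closed I.I_r_closed by simp
qed

context
  fixes M assumes M: "dp_subbimodule R \<delta> M"
begin

interpretation M: additive_subgroup M S
  using M by (simp add: dp_subbimodule_def)

lemma subbimodule_up: "p \<in> M \<Longrightarrow> p \<in> up R"
  using M.a_Hcarr by simp

lemma subbimodule_left: "p \<in> M \<Longrightarrow> r \<in> carrier R \<Longrightarrow> dp_const R \<delta> r \<otimes>\<^bsub>S\<^esub> p \<in> M"
  using M by (simp add: dp_subbimodule_def)

lemma subbimodule_right: "p \<in> M \<Longrightarrow> r \<in> carrier R \<Longrightarrow> p \<otimes>\<^bsub>S\<^esub> dp_const R \<delta> r \<in> M"
  using M by (simp add: dp_subbimodule_def)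

lemma subbimodule_add: "p \<in> M \<Longrightarrow> q \<in> M \<Longrightarrow> p \<oplus>\<^bsub>S\<^esub> q \<in> M"
  by (rule M.a_closed)

lemma subbimodule_minus: "p \<in> M \<Longrightarrow> q \<in> M \<Longrightarrow> p \<ominus>\<^bsub>S\<^esub> q \<in> M"
  unfolding a_minus_def by (intro M.a_closed M.a_inv_closed S.abelian_group_axioms)

lemma leading_coeff_ideal:
  "ideal {p d | p. p \<in> M \<and> (\<forall>i>d. p i = \<zero>)} R"
proof (rule ideal_mult_closedI)
  let ?L = "{p d | p. p \<in> M \<and> (\<forall>i>d. p i = \<zero>)}"
  show "?L \<subseteq> carrier R" using subbimodule_up by auto
  show "\<zero> \<in> ?L" using M.zero_closed by (auto simp: zero_fun)
  fix a assume "a \<in> ?L"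
  then obtain p where p: "a = p d" "p \<in> M" "\<And>i. d < i \<Longrightarrow> p i = \<zero>" by blast
  note pu = subbimodule_up[OF p(2)]
  {
    fix b assume "b \<in> ?L"
    then obtain q where q: "b = q d" "q \<in> M" "\<And>i. d < i \<Longrightarrow> q i = \<zero>" by blast
    show "a \<oplus> b \<in> ?L"
      using p q subbimodule_add[OF p(2) q(2)] pu subbimodule_up[OF q(2)]
      by (intro CollectI exI[of _ "p \<oplus>\<^bsub>S\<^esub> q"]) (simp add: add_fun)
  }
  fix r assume r: "r \<in> carrier R"
  show "r \<otimes> a \<in> ?L"
    using p r subbimodule_left[OF p(2) r] pu
    by (intro CollectI exI[of _ "dp_const R \<delta> r \<otimes>\<^bsub>S\<^esub> p"]) (simp add: dp_const_mult_coeff)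
  show "a \<otimes> r \<in> ?L"
    using p r subbimodule_right[OF p(2) r] pu
    by (intro CollectI exI[of _ "p \<otimes>\<^bsub>S\<^esub> dp_const R \<delta> r"])
      (simp add: mult_const_leading mult_const_above)
qed

end

section \<open>Outer derivations force strong simplicity\<close>

text \<open>The multiples of n form a nonzero ideal, hence all of R, so n has an inverse u in R.
  This inverse is central, and dividing by n exhibits \<open>\<delta>\<close> as a
  commutator.\<close>

lemma inner_derivationI:
  fixes n :: nat
  assumes simple: "simple_ring R" and char: "ring_characteristic R = 0"
    and n: "0 < n" and a: "a \<in> carrier R"
    and comm: "\<And>r. r \<in> carrier R \<Longrightarrow> [n] \<cdot> \<delta> r = r \<otimes> a \<ominus> a \<otimes> r"
  shows "inner_derivation R \<delta>"
proof -
  have "ideal {[n] \<cdot> r | r. r \<in> carrier R} R"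
  proof (rule ideal_mult_closedI)
    let ?I = "{[n] \<cdot> r | r. r \<in> carrier R}"
    show "?I \<subseteq> carrier R" by auto
    show "\<zero> \<in> ?I" using add.nat_pow_one[of n] by force
    fix a assume "a \<in> ?I"
    then obtain r where r: "a = [n] \<cdot> r" "r \<in> carrier R" by blast
    {
      fix b assume "b \<in> ?I"
      then obtain s where s: "b = [n] \<cdot> s" "s \<in> carrier R" by blast
      show "a \<oplus> b \<in> ?I"
        using r s add.nat_pow_distrib[of r s n] by (intro CollectI exI[of _ "r \<oplus> s"]) simp
    }
    fix s assume s: "s \<in> carrier R"
    show "s \<otimes> a \<in> ?I" using r s add_pow_rdistr[of s r n] by (intro CollectI exI[of _ "s \<otimes> r"]) simp
    show "a \<otimes> s \<in> ?I" using r s add_pow_ldistr[of r s n] by (intro CollectI exI[of _ "r \<otimes> s"]) simp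
  qed
  moreover have "[n] \<cdot> \<one> \<noteq> \<zero>"
    using char n by (simp add: ring_characteristic_eq_0_iff)
  ultimately have "{[n] \<cdot> r | r. r \<in> carrier R} = carrier R"
    using simple by (intro simple_ring_ideal_eq_carrier[where a = "[n] \<cdot> \<one>"]) auto
  then have "\<one> \<in> {[n] \<cdot> r | r. r \<in> carrier R}"
    by (rule ssubst) (rule one_closed)
  then obtain u where u: "u \<in> carrier R" "[n] \<cdot> u = \<one>"
    by auto
  have nu: "u \<otimes> [n] \<cdot> s = s" "[n] \<cdot> s \<otimes> u = s" if "s \<in> carrier R" for s
    using u that add_pow_ldistr[of u s n] add_pow_rdistr[of u s n]
      add_pow_ldistr[of s u n] add_pow_rdistr[of s u n] by auto
  \<comment> \<open>Both sides equal \<open>u (n r) u\<close>.\<close>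
  have uc: "u \<otimes> r = r \<otimes> u" if "r \<in> carrier R" for r
  proof -
    have "u \<otimes> r = u \<otimes> ([n] \<cdot> r \<otimes> u)" using nu that by simp
    also have "\<dots> = u \<otimes> [n] \<cdot> r \<otimes> u" using that u by (simp add: m_assoc)
    also have "\<dots> = r \<otimes> u" using nu(1) that by simp
    finally show ?thesis .
  qed
  show ?thesis
    unfolding inner_derivation_def
  proof (intro bexI ballI)
    \<comment> \<open>The sign of the witness reverses the commutator \<open>r a - a r\<close> of
      the hypothesis into the orientation used by \<open>inner_derivation\<close>.\<close>
    show "\<ominus> (u \<otimes> a) \<in> carrier R" using u a by simp
    fix r assume r: "r \<in> carrier R"
    have "\<delta> r = u \<otimes> (r \<otimes> a \<ominus> a \<otimes> r)"
      using nu(1)[of "\<delta> r"] comm[OF r] r by simp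
    also have "\<dots> = r \<otimes> (u \<otimes> a) \<ominus> (u \<otimes> a) \<otimes> r"
      using u a r by (simp add: a_minus_def r_distr r_minus m_assoc[symmetric] uc[OF r])
    also have "\<dots> = (\<ominus> (u \<otimes> a)) \<otimes> r \<ominus> r \<otimes> (\<ominus> (u \<otimes> a))"
      using u a r by (simp add: a_minus_def l_minus r_minus a_comm)
    finally show "\<delta> r = (\<ominus> (u \<otimes> a)) \<otimes> r \<ominus> r \<otimes> (\<ominus> (u \<otimes> a))" .
  qed
qed

lemma subbimodule_contains_lower_degrees:
  assumes simple: "simple_ring R" and char: "ring_characteristic R = 0"
    and outer: "outer_derivation R \<delta>" and M: "dp_subbimodule R \<delta> M"
    and "m \<in> M" "m d \<noteq> \<zero>" "\<And>i. d < i \<Longrightarrow> m i = \<zero>"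
    and "p \<in> up R" "\<And>i. d < i \<Longrightarrow> p i = \<zero>"
  shows "p \<in> M"
  using assms(5-)
\<comment> \<open>m is generalized because the induction hypothesis is applied to a commutator of
  lower degree, and p because it is applied to a difference.\<close>
proof (induction d arbitrary: m p)
  case 0
  have "{p 0 | p. p \<in> M \<and> (\<forall>i>0. p i = \<zero>)} = carrier R"
    using 0 by (intro simple_ring_ideal_eq_carrier[OF simple leading_coeff_ideal[OF M],
        of "m 0"]) auto
  moreover have "p 0 \<in> carrier R" using 0 by auto
  ultimately have "p 0 \<in> {p 0 | p. p \<in> M \<and> (\<forall>i>0. p i = \<zero>)}" by simp
  then obtain q where "p 0 = q 0" "q \<in> M" "\<And>i. i > 0 \<Longrightarrow> q i = \<zero>" by auto
  moreover from this have "p = q" using 0 by (metis ext gr0I)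
  ultimately show ?case by simp
next
  case (Suc d)
  let ?L = "{p (Suc d) | p. p \<in> M \<and> (\<forall>i>Suc d. p i = \<zero>)}"
  have L: "?L = carrier R"
    using Suc.prems by (intro simple_ring_ideal_eq_carrier[OF simple leading_coeff_ideal[OF M],
        of "m (Suc d)"]) auto
  then have "\<one> \<in> ?L" by simp
  then obtain q where q: "q (Suc d) = \<one>" "q \<in> M" "\<And>i. Suc d < i \<Longrightarrow> q i = \<zero>" by auto
  have qu: "q \<in> up R" by (rule subbimodule_up[OF M q(2)])
  \<comment> \<open>The commutator of q with r. As q is monic, the coefficients at
    \<open>Suc d\<close> are both r and cancel.\<close>
  define t where "t r = (q \<otimes>\<^bsub>S\<^esub> dp_const R \<delta> r) \<ominus>\<^bsub>S\<^esub> (dp_const R \<delta> r \<otimes>\<^bsub>S\<^esub> q)" for r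
  have t: "t r \<in> M" "\<And>i. d < i \<Longrightarrow> t r i = \<zero>"
    "t r d = [Suc d] \<cdot> \<delta> r \<oplus> q d \<otimes> r \<ominus> r \<otimes> q d" if r: "r \<in> carrier R" for r
  proof -
    have qd: "q d \<in> carrier R" using qu by auto
    show "t r \<in> M"
      unfolding t_def
      by (intro subbimodule_minus[OF M] subbimodule_left[OF M] subbimodule_right[OF M] q r)
    have co: "t r i = (q \<otimes>\<^bsub>S\<^esub> dp_const R \<delta> r) i \<ominus> r \<otimes> q i" for i
      using qu r by (simp add: t_def minus_coeff dp_mult_closed dp_const_mult_coeff)
    show "t r i = \<zero>" if "d < i" for i
    proof (cases "i = Suc d")
      case True
      then show ?thesis
        using mult_const_leading[OF qu r q(3)] r q(1) co by (simp add: a_minus_def r_neg)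
    next
      case False
      then show ?thesis
        using mult_const_above[of q r "Suc d" i] qu q(3) r co that by (simp add: a_minus_def)
    qed
    show "t r d = [Suc d] \<cdot> \<delta> r \<oplus> q d \<otimes> r \<ominus> r \<otimes> q d"
      using mult_const_subleading[OF qu r q(3)] r q(1) co
      by (simp del: add.nat_pow_Suc)
  qed
  \<comment> \<open>Otherwise \<open>(d+1) \<delta>(r)\<close> is the commutator of r with
    \<open>q d\<close> for every r, and \<open>inner_derivationI\<close> makes
    \<open>\<delta>\<close> inner.\<close>
  have "\<exists>r\<in>carrier R. t r d \<noteq> \<zero>"
  proof (rule ccontr)
    assume "\<not> (\<exists>r\<in>carrier R. t r d \<noteq> \<zero>)"
    then have z: "[Suc d] \<cdot> \<delta> r \<oplus> q d \<otimes> r \<ominus> r \<otimes> q d = \<zero>" if "r \<in> carrier R" for r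
      using t(3) that by auto
    have qd: "q d \<in> carrier R" using qu by auto
    have "[Suc d] \<cdot> \<delta> r = r \<otimes> q d \<ominus> q d \<otimes> r" if r: "r \<in> carrier R" for r
    proof -
      have c: "[Suc d] \<cdot> \<delta> r \<in> carrier R" "q d \<otimes> r \<in> carrier R" "r \<otimes> q d \<in> carrier R"
        using r qd add.nat_pow_closed[of "\<delta> r" "Suc d"] by auto
      have "[Suc d] \<cdot> \<delta> r \<oplus> q d \<otimes> r = r \<otimes> q d"
        using z[OF r] c r_right_minus_eq[of "[Suc d] \<cdot> \<delta> r \<oplus> q d \<otimes> r" "r \<otimes> q d"] by blast
      then have "r \<otimes> q d \<ominus> q d \<otimes> r = [Suc d] \<cdot> \<delta> r \<oplus> q d \<otimes> r \<ominus> q d \<otimes> r" by simp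
      also have "\<dots> = [Suc d] \<cdot> \<delta> r"
        using c by (simp add: a_minus_def a_assoc r_neg del: add.nat_pow_Suc)
      finally show ?thesis ..
    qed
    then show False
      using inner_derivationI[OF simple char, of "Suc d" "q d"] qd outer
      by (simp add: outer_derivation_def del: add.nat_pow_Suc)
  qed
  then obtain r where r: "r \<in> carrier R" "t r d \<noteq> \<zero>" by blast
  have low: "s \<in> M" if "s \<in> up R" "\<And>i. d < i \<Longrightarrow> s i = \<zero>" for s
    by (rule Suc.IH[OF t(1)[OF r(1)] r(2) t(2)[OF r(1)] that])
  \<comment> \<open>An element l of M with the same coefficient as p at \<open>Suc d\<close> reduces
    the claim to the difference, which has degree at most d.\<close>
  have "p (Suc d) \<in> ?L" using Suc.prems L by auto
  then obtain l where l: "p (Suc d) = l (Suc d)" "l \<in> M" "\<And>i. Suc d < i \<Longrightarrow> l i = \<zero>" by auto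
  have lu: "l \<in> up R" by (rule subbimodule_up[OF M l(2)])
  have "p \<ominus>\<^bsub>S\<^esub> l \<in> M"
  proof (rule low)
    show "p \<ominus>\<^bsub>S\<^esub> l \<in> up R" using S.minus_closed[of p l] Suc.prems lu by simp
    show "(p \<ominus>\<^bsub>S\<^esub> l) i = \<zero>" if "d < i" for i
    proof -
      have "p i = l i" using l Suc.prems(5)[of i] that by (cases "i = Suc d") auto
      then show ?thesis
        using minus_coeff[OF Suc.prems(4) lu] lu r_right_minus_eq[of "l i" "l i"]
        by (simp add: mem_upD)
    qed
  qed
  then have "(p \<ominus>\<^bsub>S\<^esub> l) \<oplus>\<^bsub>S\<^esub> l \<in> M" using l(2) by (rule subbimodule_add[OF M])
  moreover have "(p \<ominus>\<^bsub>S\<^esub> l) \<oplus>\<^bsub>S\<^esub> l = p"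
    using Suc.prems lu S.diff_add_cancel_carrier[of p l] by simp
  ultimately show ?case by simp
qed

text \<open>The cases are whether the degrees occurring in M are bounded. If so, M is the filtration
  step of the greatest degree n that occurs; if not, every polynomial lies below the degree of some
  element of M.\<close>

lemma outer_imp_strongly_simple:
  assumes "simple_ring R" "ring_characteristic R = 0" "outer_derivation R \<delta>"
  shows "strongly_simple R \<delta>"
  unfolding strongly_simple_def
proof (intro allI impI, elim conjE)
  fix M assume M: "dp_subbimodule R \<delta> M" and nz: "M \<noteq> {\<zero>\<^bsub>S\<^esub>}"
  note low = subbimodule_contains_lower_degrees[OF assms M]
  interpret M: additive_subgroup M S
    using M by (simp add: dp_subbimodule_def)
  obtain m where m: "m \<in> M" "m \<noteq> \<zero>\<^bsub>UP R\<^esub>" using nz M.zero_closed by auto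
  obtain d where d: "m d \<noteq> \<zero>" using m up_nonzero_leading subbimodule_up[OF M] by metis
  show "M = carrier S \<or> (\<exists>n. M = dp_filtration R \<delta> n)"
  proof (cases "\<exists>N. \<forall>p\<in>M. \<forall>i>N. p i = \<zero>")
    case True
    then obtain N where N: "\<And>p i. p \<in> M \<Longrightarrow> N < i \<Longrightarrow> p i = \<zero>" by blast
    let ?P = "\<lambda>n. \<exists>p\<in>M. p n \<noteq> \<zero>"
    have P: "?P d" using m d by blast
    have b: "n \<le> N" if "?P n" for n using N that by (meson not_less)
    define n where "n = (GREATEST n. ?P n)"
    have n: "?P n" unfolding n_def by (rule GreatestI_nat[of ?P, OF P b])
    have "i \<le> n" if "?P i" for i
      unfolding n_def by (rule Greatest_le_nat[of ?P, OF that b])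
    then have ab: "p i = \<zero>" if "p \<in> M" "n < i" for p i using that by (meson not_less)
    obtain w where w: "w \<in> M" "w n \<noteq> \<zero>" using n by blast
    have "p \<in> M" if "p \<in> up R" "\<forall>i>n. p i = \<zero>" for p
      by (rule low[OF w]) (use that ab[OF w(1)] in blast)+
    then have "M = dp_filtration R \<delta> n"
      unfolding dp_filtration_eq using ab subbimodule_up[OF M] by blast
    then show ?thesis by blast
  next
    case False
    have "p \<in> M" if p: "p \<in> up R" for p
    proof -
      obtain N where N: "\<And>i. N < i \<Longrightarrow> p i = \<zero>" using up_bound_ex[OF p] by blast
      obtain q i where q: "q \<in> M" "N < i" "q i \<noteq> \<zero>" using False by blast
      obtain e where e: "q e \<noteq> \<zero>" "\<And>j. e < j \<Longrightarrow> q j = \<zero>"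
        using up_nonzero_leading[of q] q subbimodule_up[OF M] by (metis zero_fun)
      have "N < e" using e(2) q by (metis less_trans not_less_iff_gr_or_eq)
      show ?thesis
        by (rule low[OF q(1) e(1)]) (use e(2) p N \<open>N < e\<close> less_trans in blast)+
    qed
    then show ?thesis using subbimodule_up[OF M] by auto
  qed
qed

section \<open>Consequences of strong simplicity\<close>

context
  assumes nontrivial: "carrier R \<noteq> {\<zero>}"
begin

lemma one_neq_zero: "\<one> \<noteq> \<zero>"
  using nontrivial carrier_one_not_zero by simp

lemma monom_one_nonzero: "monom (UP R) \<one> n \<noteq> \<zero>\<^bsub>UP R\<^esub>"
proof
  assume "monom (UP R) \<one> n = \<zero>\<^bsub>UP R\<^esub>"
  then have "monom (UP R) \<one> n n = \<zero>" by (simp add: zero_fun)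
  then show False using one_neq_zero by (simp add: monom_fun)
qed

text \<open>An ideal I of R, placed in degree zero, is a sub-bimodule. The whole ring and every
  filtration step contain the constant one, so one lies in I.\<close>

lemma strongly_simple_imp_simple:
  assumes "strongly_simple R \<delta>"
  shows "simple_ring R"
proof -
  have "I = carrier R" if I: "ideal I R" and nz: "I \<noteq> {\<zero>}" for I
  proof -
    interpret I: ideal I R by fact
    let ?M = "{p \<in> up R. p 0 \<in> I \<and> (\<forall>i>0. p i = \<zero>)}"
    have "dp_subbimodule R \<delta> ?M"
    proof (rule subbimoduleI)
      show "p \<oplus>\<^bsub>UP R\<^esub> q \<in> ?M" if "p \<in> ?M" "q \<in> ?M" for p q
        using that by (simp add: add_fun up_add_closed)
      show "dp_const R \<delta> r \<otimes>\<^bsub>S\<^esub> p \<in> ?M" "p \<otimes>\<^bsub>S\<^esub> dp_const R \<delta> r \<in> ?M"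
        if "r \<in> carrier R" "p \<in> ?M" for r p
        using that
        by (simp_all add: dp_const_mult_coeff dp_mult_closed mult_const_leading mult_const_above
            I.I_l_closed I.I_r_closed)
    qed (auto simp: zero_fun bound_def intro!: mem_upI)
    moreover have c: "dp_const R \<delta> a \<in> ?M" if "a \<in> I" for a
      using that I.a_Hcarr[OF that] dp_const_closed[of a] by (simp add: dp_const_fun)
    moreover obtain a where a: "a \<in> I" "a \<noteq> \<zero>" using nz I.zero_closed by auto
    then have "dp_const R \<delta> a \<noteq> \<zero>\<^bsub>S\<^esub>"
      using I.a_Hcarr by (auto simp: dp_const_fun zero_fun fun_eq_iff)
    ultimately have "?M \<noteq> {\<zero>\<^bsub>S\<^esub>}" using a(1) by blast
    then have "?M = up R \<or> (\<exists>n. ?M = dp_filtration R \<delta> n)"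
      using assms \<open>dp_subbimodule R \<delta> ?M\<close> by (auto simp: strongly_simple_def)
    then have "dp_const R \<delta> \<one> \<in> ?M"
      using dp_const_closed[OF one_closed]
      by (elim disjE exE) (simp_all add: dp_filtration_eq dp_const_fun)
    then have "\<one> \<in> I" by (simp add: dp_const_fun)
    then show ?thesis by (rule I.one_imp_carrier)
  qed
  then show ?thesis
    using ring_axioms nontrivial by (auto simp: simple_ring_def)
qed

text \<open>
  If \<open>n \<cdot> \<one> = \<zero>\<close>, then \<open>x\<^sup>n r - r x\<^sup>n\<close> has degree at most \<open>n - 2\<close>, so the polynomials of degree
  at most \<open>n\<close> without \<open>x\<^bsup>n-1\<^esup>\<close>-term form a sub-bimodule that is not a filtration step.
\<close>

lemma strongly_simple_imp_char_0:
  assumes "strongly_simple R \<delta>"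
  shows "ring_characteristic R = 0"
proof (rule ccontr)
  assume "ring_characteristic R \<noteq> 0"
  then obtain n :: nat where "0 < n" "[n] \<cdot> \<one> = \<zero>"
    by (auto simp: ring_characteristic_eq_0_iff)
  then obtain k where k: "[Suc k] \<cdot> \<one> = \<zero>" by (cases n) auto
  \<comment> \<open>This kills the \<open>\<delta> r\<close> term in
    \<open>mult_const_subleading\<close>, which gives right closure of \<open>?M\<close>; k = n - 1
    is the index of the omitted term.\<close>
  have tors: "[Suc k] \<cdot> a = \<zero>" if "a \<in> carrier R" for a
    using add_pow_ldistr[of \<one> a "Suc k"] k that by (simp del: add.nat_pow_Suc)
  let ?M = "{p \<in> up R. p k = \<zero> \<and> (\<forall>i>Suc k. p i = \<zero>)}"
  have "dp_subbimodule R \<delta> ?M"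
  proof (rule subbimoduleI)
    show "p \<oplus>\<^bsub>UP R\<^esub> q \<in> ?M" if "p \<in> ?M" "q \<in> ?M" for p q
      using that by (simp add: add_fun up_add_closed)
    show "dp_const R \<delta> r \<otimes>\<^bsub>S\<^esub> p \<in> ?M" if "r \<in> carrier R" "p \<in> ?M" for r p
      using that by (simp add: dp_const_mult_coeff dp_mult_closed)
    show "p \<otimes>\<^bsub>S\<^esub> dp_const R \<delta> r \<in> ?M" if "r \<in> carrier R" "p \<in> ?M" for r p
      using that tors[of "\<delta> r"]
      by (simp add: dp_mult_closed mult_const_subleading mult_const_above mem_upD
          del: add.nat_pow_Suc)
  qed (auto simp: zero_fun bound_def intro!: mem_upI)
  moreover have x: "monom (UP R) \<one> (Suc k) \<in> ?M"
    using monom_up[OF one_closed, of "Suc k"] by (simp add: monom_fun)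
  moreover have "monom (UP R) \<one> (Suc k) \<noteq> \<zero>\<^bsub>S\<^esub>"
    using monom_one_nonzero by simp
  ultimately have "?M = up R \<or> (\<exists>n. ?M = dp_filtration R \<delta> n)"
    using assms by (auto simp: strongly_simple_def)
  then have "monom (UP R) \<one> k \<in> ?M"
  proof (elim disjE exE)
    fix n assume e: "?M = dp_filtration R \<delta> n"
    \<comment> \<open>\<open>x^(k+1)\<close> lies in \<open>?M\<close>, so the filtration step
      reaches degree k+1 and therefore contains the excluded \<open>x^k\<close>.\<close>
    have "Suc k \<le> n"
      using x one_neq_zero unfolding e by (auto simp: dp_filtration_eq monom_fun not_less[symmetric])
    then show ?thesis
      using monom_up[OF one_closed, of k] unfolding e by (simp add: dp_filtration_eq monom_fun)
  next
    assume "?M = up R"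
    then show ?thesis using monom_up[OF one_closed, of k] by (rule ssubst)
  qed
  then show False using one_neq_zero by (simp add: monom_fun)
qed

text \<open>No filtration step is an ideal: left multiplication by x sends \<open>x^n\<close> out of
  the step of degree n.\<close>

lemma strongly_simple_imp_simple_diff_poly:
  assumes "strongly_simple R \<delta>"
  shows "simple_ring S"
proof -
  have "I = up R" if I: "ideal I S" and nz: "I \<noteq> {\<zero>\<^bsub>S\<^esub>}" for I
  proof (rule ccontr)
    interpret I: ideal I S by fact
    assume "I \<noteq> up R"
    then obtain n where n: "I = dp_filtration R \<delta> n"
      using assms nz ideal_is_subbimodule[OF I] by (auto simp: strongly_simple_def)
    have "monom (UP R) \<one> n \<in> I"
      using monom_up[OF one_closed, of n] unfolding n by (simp add: dp_filtration_eq monom_fun)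
    then have "monom (UP R) \<one> 1 \<otimes>\<^bsub>S\<^esub> monom (UP R) \<one> n \<in> I"
      using monom_up[OF one_closed, of 1] by (intro I.I_l_closed) auto
    then have "monom (UP R) \<one> (Suc n) \<in> I"
      using dp_monom_one_mult[of 1 n] by simp
    then show False
      using one_neq_zero unfolding n by (auto simp: dp_filtration_eq monom_fun)
  qed
  moreover have "carrier S \<noteq> {\<zero>\<^bsub>S\<^esub>}"
    using monom_up[OF one_closed, of 0] monom_one_nonzero[of 0] by auto
  ultimately show ?thesis
    using dp_ring by (auto simp: simple_ring_def)
qed

end

section \<open>Inner derivations and the central element x - a\<close>

text \<open>The witness is \<open>c = x - a\<close>.\<close>

lemma inner_central_element:
  assumes a: "a \<in> carrier R" and inner: "\<And>r. r \<in> carrier R \<Longrightarrow> \<delta> r = a \<otimes> r \<ominus> r \<otimes> a"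
  obtains c where "c \<in> up R" "c 1 = \<one>"
    and "\<And>s. s \<in> up R \<Longrightarrow> c \<otimes>\<^bsub>S\<^esub> s = s \<otimes>\<^bsub>S\<^esub> c"
    and "\<And>s n. s \<in> up R \<Longrightarrow> (c \<otimes>\<^bsub>S\<^esub> s) (Suc n) = s n \<ominus> s (Suc n) \<otimes> a"
proof -
  let ?c = "\<lambda>i::nat. if i = 0 then \<ominus> a else if i = 1 then \<one> else \<zero>"
  let ?shift = "\<lambda>s n. case n of 0 \<Rightarrow> \<zero> | Suc m \<Rightarrow> s m"
  have c: "?c \<in> up R"
    using a by (auto simp: bound_def intro!: mem_upI exI[of _ 1])
  have da: "\<delta> (\<ominus> a) = \<zero>"
    using inner[of "\<ominus> a"] a by (simp add: l_minus r_minus)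
  \<comment> \<open>Since \<open>\<delta>\<close> vanishes on -a, x commutes with a, so
    \<open>x^i c = x^(i+1) - a x^i\<close>.\<close>
  have xc: "(xm ^^ i) ?c = (\<lambda>n. if n = i then \<ominus> a else if n = Suc i then \<one> else \<zero>)" for i
  proof (induction i)
    case (Suc i)
    have "(xm ^^ Suc i) ?c n = (if n = Suc i then \<ominus> a else if n = Suc (Suc i) then \<one> else \<zero>)" for n
      unfolding funpow.simps o_apply Suc dp_x_mult_def using a da by (cases n) simp_all
    then show ?case by blast
  qed (auto simp: fun_eq_iff)
  \<comment> \<open>In \<open>x s - a s\<close> the term
    \<open>\<delta>(s n) = a s_n - s_n a\<close> trades the left factor a for a right one; the
    result agrees with the coefficients of \<open>s x - s a\<close>, computed under
    \<open>right\<close>.\<close>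
  have left: "(?c \<otimes>\<^bsub>S\<^esub> s) n = ?shift s n \<ominus> s n \<otimes> a" if s: "s \<in> up R" for s n
  proof -
    have sc: "s n \<in> carrier R" "?shift s n \<in> carrier R" using s by (auto split: nat.split)
    have "(?c \<otimes>\<^bsub>S\<^esub> s) n = (\<Oplus>i\<in>{..Suc 0}. ?c i \<otimes> (xm ^^ i) s n)"
      by (rule dp_mult_coeff) (use c s in auto)
    also have "\<dots> = (?shift s n \<oplus> \<delta> (s n)) \<oplus> (\<ominus> a) \<otimes> s n"
      using a sc s by (simp add: dp_x_mult_def Pi_def)
    also have "\<dots> = ?shift s n \<ominus> s n \<otimes> a"
      using a sc
      by (simp add: inner a_minus_def l_minus a_assoc) (simp add: a_comm r_neg2 r_neg)
    finally show ?thesis .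
  qed
  have right: "(s \<otimes>\<^bsub>S\<^esub> ?c) n = ?shift s n \<ominus> s n \<otimes> a" if s: "s \<in> up R" for s n
  proof -
    have sc: "s i \<in> carrier R" for i using s by auto
    obtain N where N: "\<And>i. N < i \<Longrightarrow> s i = \<zero>" using up_bound_ex[OF s] by blast
    \<comment> \<open>The range must reach n as well as N, so that the single indices n and n - 1
      (for positive n) can be picked out of the two sums below.\<close>
    let ?A = "{..max N n}"
    have "(s \<otimes>\<^bsub>S\<^esub> ?c) n = (\<Oplus>i\<in>?A. s i \<otimes> (xm ^^ i) ?c n)"
      by (rule dp_mult_coeff) (use c s N in auto)
    also have "\<dots> = (\<Oplus>i\<in>?A. (if n = i then s i \<otimes> (\<ominus> a) else \<zero>) \<oplus> (if n = Suc i then s i else \<zero>))"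
      unfolding xc using sc a by (intro finsum_cong') auto
    also have "\<dots> = (\<Oplus>i\<in>?A. if n = i then s i \<otimes> (\<ominus> a) else \<zero>) \<oplus> (\<Oplus>i\<in>?A. if n = Suc i then s i else \<zero>)"
      using sc a by (intro finsum_addf) auto
    also have "(\<Oplus>i\<in>?A. if n = i then s i \<otimes> (\<ominus> a) else \<zero>) = s n \<otimes> (\<ominus> a)"
      using sc a by (intro finsum_singleton) auto
    also have "(\<Oplus>i\<in>?A. if n = Suc i then s i else \<zero>) = ?shift s n"
    proof (cases n)
      case (Suc m)
      then show ?thesis
        using sc finsum_singleton[of m ?A s] by auto
    qed simp
    finally show ?thesis
      using sc a by (simp add: a_minus_def r_minus a_comm split: nat.split)
  qed
  show ?thesis
  proof (rule that[of ?c])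
    show "?c \<otimes>\<^bsub>S\<^esub> s = s \<otimes>\<^bsub>S\<^esub> ?c" if "s \<in> up R" for s
      using left[OF that] right[OF that] by (auto simp: fun_eq_iff)
    show "(?c \<otimes>\<^bsub>S\<^esub> s) (Suc n) = s n \<ominus> s (Suc n) \<otimes> a" if "s \<in> up R" for s n
      using left[OF that, of "Suc n"] by simp
  qed (use c in auto)
qed

text \<open>Centrality of c makes its multiples a two-sided ideal, so simplicity of \<open>S\<close>
  would make c invertible. Yet c is monic of degree one, so \<open>c q\<close> has degree one more
  than a nonzero q and cannot be 1.\<close>

lemma simple_diff_poly_imp_outer:
  assumes nontrivial: "carrier R \<noteq> {\<zero>}" and simple: "simple_ring S"
  shows "outer_derivation R \<delta>"
  unfolding outer_derivation_def
proof
  assume "inner_derivation R \<delta>"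
  then obtain a where a: "a \<in> carrier R" "\<And>r. r \<in> carrier R \<Longrightarrow> \<delta> r = a \<otimes> r \<ominus> r \<otimes> a"
    by (auto simp: inner_derivation_def)
  obtain c where c: "c \<in> up R" "c 1 = \<one>"
    and cc: "\<And>s. s \<in> up R \<Longrightarrow> c \<otimes>\<^bsub>S\<^esub> s = s \<otimes>\<^bsub>S\<^esub> c"
    and cm: "\<And>s n. s \<in> up R \<Longrightarrow> (c \<otimes>\<^bsub>S\<^esub> s) (Suc n) = s n \<ominus> s (Suc n) \<otimes> a"
    using inner_central_element[OF a] by blast
  have cS: "c \<in> carrier S" using c by simp
  let ?I = "{c \<otimes>\<^bsub>S\<^esub> q | q. q \<in> carrier S}"
  have I: "ideal ?I S"
  proof (rule S.ideal_mult_closedI)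
    show "?I \<subseteq> carrier S" using cS S.m_closed by blast
    have "c \<otimes>\<^bsub>S\<^esub> \<zero>\<^bsub>S\<^esub> = \<zero>\<^bsub>S\<^esub>" by (rule S.r_null[OF cS])
    then show "\<zero>\<^bsub>S\<^esub> \<in> ?I" using S.zero_closed by (intro CollectI exI[of _ "\<zero>\<^bsub>S\<^esub>"]) (rule conjI, rule sym)
    fix p assume "p \<in> ?I"
    then obtain q where q: "p = c \<otimes>\<^bsub>S\<^esub> q" "q \<in> carrier S" by blast
    {
      fix p' assume "p' \<in> ?I"
      then obtain q' where q': "p' = c \<otimes>\<^bsub>S\<^esub> q'" "q' \<in> carrier S" by blast
      show "p \<oplus>\<^bsub>S\<^esub> p' \<in> ?I"
        using q q' S.r_distr[OF q(2) q'(2) cS] S.a_closed[OF q(2) q'(2)]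
        by (intro CollectI exI[of _ "q \<oplus>\<^bsub>S\<^esub> q'"]) simp
    }
    fix s assume s: "s \<in> carrier S"
    have "s \<otimes>\<^bsub>S\<^esub> p = (s \<otimes>\<^bsub>S\<^esub> c) \<otimes>\<^bsub>S\<^esub> q"
      using q s cS S.m_assoc by simp
    also have "\<dots> = c \<otimes>\<^bsub>S\<^esub> (s \<otimes>\<^bsub>S\<^esub> q)"
      using q s cS cc[of s] S.m_assoc[OF cS s q(2)] by simp
    finally show "s \<otimes>\<^bsub>S\<^esub> p \<in> ?I" using S.m_closed[OF s q(2)] by blast
    have "p \<otimes>\<^bsub>S\<^esub> s = c \<otimes>\<^bsub>S\<^esub> (q \<otimes>\<^bsub>S\<^esub> s)"
      unfolding q(1) by (rule S.m_assoc[OF cS q(2) s])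
    then show "p \<otimes>\<^bsub>S\<^esub> s \<in> ?I" using S.m_closed[OF q(2) s] by blast
  qed
  have "c \<in> ?I"
    using S.r_one[OF cS] S.one_closed by (intro CollectI exI[of _ "\<one>\<^bsub>S\<^esub>"]) (rule conjI, rule sym)
  have "c \<noteq> \<zero>\<^bsub>S\<^esub>" using c one_neq_zero[OF nontrivial] by (auto simp: zero_fun)
  then have "?I = carrier S"
    by (rule simple_ring_ideal_eq_carrier[OF simple I \<open>c \<in> ?I\<close>])
  then have "\<one>\<^bsub>S\<^esub> \<in> ?I" by (rule ssubst) (rule S.one_closed)
  then obtain q where q: "\<one>\<^bsub>S\<^esub> = c \<otimes>\<^bsub>S\<^esub> q" "q \<in> carrier S" by blast
  have "q \<noteq> \<zero>\<^bsub>S\<^esub>"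
  proof
    assume "q = \<zero>\<^bsub>S\<^esub>"
    then have "\<one>\<^bsub>S\<^esub> = \<zero>\<^bsub>S\<^esub>" using q(1) S.r_null[OF cS] by metis
    then show False using monom_one_nonzero[OF nontrivial, of 0] by (simp add: UP_one_monom)
  qed
  then obtain d where d: "q d \<noteq> \<zero>" "\<And>i. d < i \<Longrightarrow> q i = \<zero>"
    using up_nonzero_leading[of q] q(2) by auto
  have "q d \<in> carrier R" using q(2) by auto
  then have "(c \<otimes>\<^bsub>S\<^esub> q) (Suc d) = q d"
    using cm[of q d] d(2)[of "Suc d"] q(2) a by (simp add: a_minus_def)
  then have "q d = \<zero>"
    using q(1)[symmetric] by (simp add: UP_one_monom monom_fun)
  with d show False by simp
qed

section \<open>The centralizer of R\<close>

lemma const_center_subset_centralizer: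
  "dp_const R \<delta> ` ring_center R \<subseteq> ring_centralizer S (dp_const R \<delta> ` carrier R)"
proof -
  have "dp_const R \<delta> z \<otimes>\<^bsub>S\<^esub> dp_const R \<delta> r = dp_const R \<delta> r \<otimes>\<^bsub>S\<^esub> dp_const R \<delta> z"
    if "z \<in> carrier R" "r \<in> carrier R" "z \<otimes> r = r \<otimes> z" for z r
    using that ring_hom_mult[OF dp_const_hom, of z r] ring_hom_mult[OF dp_const_hom, of r z] by simp
  then show ?thesis
    by (auto simp: ring_center_def ring_centralizer_def)
qed

lemma centralizer_eq_center_imp_outer:
  assumes "carrier R \<noteq> {\<zero>}"
    and cent: "ring_centralizer S (dp_const R \<delta> ` carrier R) = dp_const R \<delta> ` ring_center R"
  shows "outer_derivation R \<delta>"
  unfolding outer_derivation_def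
proof
  assume "inner_derivation R \<delta>"
  then obtain a where a: "a \<in> carrier R" "\<And>r. r \<in> carrier R \<Longrightarrow> \<delta> r = a \<otimes> r \<ominus> r \<otimes> a"
    by (auto simp: inner_derivation_def)
  obtain c where c: "c \<in> up R" "c 1 = \<one>"
    and cc: "\<And>s. s \<in> up R \<Longrightarrow> c \<otimes>\<^bsub>S\<^esub> s = s \<otimes>\<^bsub>S\<^esub> c"
    using inner_central_element[OF a] by metis
  have "c \<in> ring_centralizer S (dp_const R \<delta> ` carrier R)"
    using c cc by (auto simp: ring_centralizer_def)
  then obtain z where "z \<in> carrier R" "c = dp_const R \<delta> z"
    using cent by (auto simp: ring_center_def)
  \<comment> \<open>A constant has coefficient zero at index 1, whereas \<open>c 1\<close> is
    one.\<close>
  then show False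
    using c one_neq_zero[OF assms(1)] by (simp add: dp_const_fun)
qed

text \<open>
  A centralizing element \<open>s\<close> of positive degree generates the sub-bimodule \<open>R s\<close>. Containing \<open>1\<close>
  and the monomial \<open>x\<^sup>d\<close> with \<open>d = deg s\<close>, it makes the central leading coefficient of \<open>s\<close> both a
  zero divisor and a unit.
\<close>

lemma outer_imp_centralizer_eq_center:
  assumes simple: "simple_ring R" and char: "ring_characteristic R = 0"
    and outer: "outer_derivation R \<delta>"
  shows "ring_centralizer S (dp_const R \<delta> ` carrier R) = dp_const R \<delta> ` ring_center R"
proof (intro equalityI const_center_subset_centralizer subsetI)
  fix s assume "s \<in> ring_centralizer S (dp_const R \<delta> ` carrier R)"
  then have s: "s \<in> up R"
    and comm: "\<And>r. r \<in> carrier R \<Longrightarrow> s \<otimes>\<^bsub>S\<^esub> dp_const R \<delta> r = dp_const R \<delta> r \<otimes>\<^bsub>S\<^esub> s"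
    by (auto simp: ring_centralizer_def)
  have sc: "s i \<in> carrier R" for i using s by auto
  \<comment> \<open>Compare the coefficients at d in \<open>s r = r s\<close>. The bound d is left
    variable: it is the degree of s at first and 0 at the end.\<close>
  have central: "s d \<otimes> r = r \<otimes> s d"
    if "r \<in> carrier R" "\<And>i. d < i \<Longrightarrow> s i = \<zero>" for r d
    using mult_const_leading[OF s that] comm[OF that(1)] dp_const_mult_coeff[OF that(1) s, of d]
    by simp
  have one: "\<one> \<noteq> \<zero>"
    using simple one_neq_zero by (auto simp: simple_ring_def)
  have "s i = \<zero>" if i: "0 < i" for i
  proof (rule ccontr)
    assume "s i \<noteq> \<zero>"
    then obtain d where d: "s d \<noteq> \<zero>" "\<And>j. d < j \<Longrightarrow> s j = \<zero>"
      using up_nonzero_leading[OF s] by (metis zero_fun)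
    have "0 < d" using d(2)[of i] i \<open>s i \<noteq> \<zero>\<close> by (cases d) auto
    let ?M = "{dp_const R \<delta> r \<otimes>\<^bsub>S\<^esub> s | r. r \<in> carrier R}"
    have M: "dp_subbimodule R \<delta> ?M"
    proof (rule subbimoduleI)
      show "?M \<subseteq> up R" using dp_mult_closed s by auto
      have "dp_const R \<delta> \<zero> \<otimes>\<^bsub>S\<^esub> s = \<zero>\<^bsub>UP R\<^esub>"
        using s sc by (auto simp: fun_eq_iff zero_fun dp_const_mult_coeff)
      then show "\<zero>\<^bsub>UP R\<^esub> \<in> ?M" by (metis (mono_tags, lifting) CollectI zero_closed)
      fix p assume "p \<in> ?M"
      then obtain u where u: "p = dp_const R \<delta> u \<otimes>\<^bsub>S\<^esub> s" "u \<in> carrier R" by blast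
      {
        fix q assume "q \<in> ?M"
        then obtain v where v: "q = dp_const R \<delta> v \<otimes>\<^bsub>S\<^esub> s" "v \<in> carrier R" by blast
        have "p \<oplus>\<^bsub>UP R\<^esub> q = dp_const R \<delta> (u \<oplus> v) \<otimes>\<^bsub>S\<^esub> s"
          using u v s ring_hom_add[OF dp_const_hom u(2) v(2)] by (simp add: dp_l_distr)
        then show "p \<oplus>\<^bsub>UP R\<^esub> q \<in> ?M" using u v by blast
      }
      fix r assume r: "r \<in> carrier R"
      have "dp_const R \<delta> r \<otimes>\<^bsub>S\<^esub> p = dp_const R \<delta> (r \<otimes> u) \<otimes>\<^bsub>S\<^esub> s"
        using u r s ring_hom_mult[OF dp_const_hom r u(2)] by (simp add: dp_m_assoc)
      then show "dp_const R \<delta> r \<otimes>\<^bsub>S\<^esub> p \<in> ?M" using u r by blast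
      \<comment> \<open>Right closure holds because s commutes with constants:
        \<open>(u s) r = u (r s) = (u r) s\<close>.\<close>
      have "p \<otimes>\<^bsub>S\<^esub> dp_const R \<delta> r = dp_const R \<delta> u \<otimes>\<^bsub>S\<^esub> (dp_const R \<delta> r \<otimes>\<^bsub>S\<^esub> s)"
        using u r s by (simp add: dp_m_assoc comm)
      also have "\<dots> = dp_const R \<delta> (u \<otimes> r) \<otimes>\<^bsub>S\<^esub> s"
        using u r s ring_hom_mult[OF dp_const_hom u(2) r] by (simp add: dp_m_assoc)
      finally show "p \<otimes>\<^bsub>S\<^esub> dp_const R \<delta> r \<in> ?M" using u r by blast
    qed
    have "dp_const R \<delta> \<one> \<otimes>\<^bsub>S\<^esub> s = s"
      using s sc by (simp add: fun_eq_iff dp_const_mult_coeff)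
    then have sM: "s \<in> ?M" by (metis (mono_tags, lifting) CollectI one_closed)
    have mem: "monom (UP R) \<one> j \<in> ?M" if "j \<le> d" for j
      by (rule subbimodule_contains_lower_degrees[OF simple char outer M sM d])
        (use that monom_up[OF one_closed, of j] in \<open>auto simp: monom_fun[OF one_closed]\<close>)
    obtain u where u: "monom (UP R) \<one> 0 = dp_const R \<delta> u \<otimes>\<^bsub>S\<^esub> s" "u \<in> carrier R"
      using mem[of 0] by auto
    obtain v where v: "monom (UP R) \<one> d = dp_const R \<delta> v \<otimes>\<^bsub>S\<^esub> s" "v \<in> carrier R"
      using mem[of d] by auto
    \<comment> \<open>Coefficients at 0 and d of \<open>u s = 1\<close>, and at d of
      \<open>v s = x^d\<close>; the middle equation relies on \<open>0 < d\<close>.\<close>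
    have u0: "u \<otimes> s 0 = \<one>" and ud: "u \<otimes> s d = \<zero>" and vd: "v \<otimes> s d = \<one>"
      using u v \<open>0 < d\<close> dp_const_mult_coeff[OF _ s]
      by (metis monom_fun one_closed less_irrefl)+
    \<comment> \<open>Centrality of \<open>s d\<close> turns \<open>v s_d = 1\<close> into
      \<open>s_d v = 1\<close>, so \<open>u s_d = 0\<close> forces u = 0, contrary to
      \<open>u0\<close>.\<close>
    have "u = u \<otimes> (s d \<otimes> v)"
      using vd central[OF v(2) d(2)] u(2) by simp
    also have "\<dots> = \<zero>"
      using ud u(2) v(2) sc by (simp add: m_assoc[symmetric])
    finally show False using u0 one sc by simp
  qed
  then have "s = dp_const R \<delta> (s 0)" "s 0 \<in> ring_center R"
    using sc central[of _ 0] by (auto simp: dp_const_fun fun_eq_iff ring_center_def)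
  then show "s \<in> dp_const R \<delta> ` ring_center R" by blast
qed

end

theorem theorem1p2:
  fixes R :: "('a, 'm) ring_scheme" and \<delta> :: "'a \<Rightarrow> 'a"
  assumes "ring R" and "carrier R \<noteq> {\<zero>\<^bsub>R\<^esub>}" and "ring_derivation R \<delta>"
  shows
    "(strongly_simple R \<delta> \<longleftrightarrow>
        simple_ring R \<and> ring_characteristic R = 0 \<and> simple_ring (diff_poly R \<delta>)) \<and>
     (simple_ring R \<and> ring_characteristic R = 0 \<and> simple_ring (diff_poly R \<delta>) \<longleftrightarrow>
        simple_ring R \<and> ring_characteristic R = 0 \<and> outer_derivation R \<delta>) \<and>
     (simple_ring R \<and> ring_characteristic R = 0 \<and> outer_derivation R \<delta> \<longleftrightarrow>
        simple_ring R \<and> ring_characteristic R = 0 \<and>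
        ring_centralizer (diff_poly R \<delta>) (dp_const R \<delta> ` carrier R) = dp_const R \<delta> ` ring_center R)"
proof -
  interpret ring_derivation R \<delta> by fact
  show ?thesis
    \<comment> \<open>The implications form the cycle (i), (ii), (iii), (i), together with (iii) to
      (iv) and back.\<close>
    using strongly_simple_imp_simple[OF assms(2)] strongly_simple_imp_char_0[OF assms(2)]
      strongly_simple_imp_simple_diff_poly[OF assms(2)] simple_diff_poly_imp_outer[OF assms(2)]
      outer_imp_strongly_simple centralizer_eq_center_imp_outer[OF assms(2)]
      outer_imp_centralizer_eq_center
    by blast
qed

end
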